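(* Let $\mathfrak{L}_\pm$ be dual definite subspaces of the Krein space $(\mathfrak{H},[\cdot,\cdot])$ whose algebraic sum $\mathcal{D}=\mathfrak{L}_++\mathfrak{L}_-$ is dense in $\mathfrak{H}$, and assume that $T_\mu\neq T_M$. Let the Krein space $(\mathfrak{M},[\cdot,\cdot])$, $\mathfrak{M}=\overline{R(T_M-T_\mu)}$, contain a hypermaximal neutral subspace. Then there exist infinitely many extensions of $\mathfrak{L}_\pm$ to dual maximal definite subspaces $\mathfrak{L}_\pm^{max}\supset\mathfrak{L}_\pm$ such that $\mathcal{D}$ is a dense set in the Hilbert space $(\mathfrak{H}_G,(\cdot,\cdot)_G)$ associated with $\mathcal{D}_{max}=\mathfrak{L}_+^{max}+\mathfrak{L}_-^{max}$, and, at the same time, there exist infinitely many extensions of $\mathfrak{L}_\pm$ to dual maximal definite subspaces $\mathfrak{L}_\pm^{max}\supset\mathfrak{L}_\pm$ such that $\mathcal{D}$ is not dense in the corresponding Hilbert space $(\mathfrak{H}_G,(\cdot,\cdot)_G)$.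
   Context: $\mathfrak{H}$ is a complex Hilbert space with inner product $(\cdot,\cdot)$ (linear in the first argument), $J$ is a bounded operator with $J=J^*$, $J^2=I$, $J\neq\pm I$, and $[f,g]=(Jf,g)$. Put $P_\pm=\frac12(I\pm J)$, $\mathfrak{H}_\pm=P_\pm\mathfrak{H}$. Subspaces are closed. A subspace $\mathfrak{L}$ is positive (negative) if $[f,f]>0$ ($<0$) for all nonzero $f\in\mathfrak{L}$, and maximal positive (negative) if it is not a proper subspace of another positive (negative) subspace. Dual definite subspaces $\mathfrak{L}_\pm$: $\mathfrak{L}_+$ positive, $\mathfrak{L}_-$ negative, $[f_+,f_-]=0$ for all $f_\pm\in\mathfrak{L}_\pm$; dual maximal definite if moreover $\mathfrak{L}_+$ is maximal positive and $\mathfrak{L}_-$ is maximal negative. Associated operator: $\mathfrak{L}_\pm$ can be written uniquely as $\mathfrak{L}_+=\{x_++K_+^-x_+:x_+\in M_+\}$, $\mathfrak{L}_-=\{x_-+K_-^+x_-:x_-\in M_-\}$ with $M_\pm$ closed subspaces of $\mathfrak{H}_\pm$ and $K_+^-:M_+\to\mathfrak{H}_-$, $K_-^+:M_-\to\mathfrak{H}_+$ strong contractions ($\|Kf\|<\|f\|$ for $f\neq0$). Put $T_0=K_+^-P_++K_-^+P_-$, $D(T_0)=M_+\oplus M_-$ (a symmetric strong contraction with $JT_0=-T_0J$). The set of all self-adjoint contractive extensions of $T_0$ (defined on $\mathfrak{H}$) is an operator interval $[T_\mu,T_M]$. The subspace $\mathfrak{M}=\overline{R(T_M-T_\mu)}$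 reduces $J$, so $(\mathfrak{M},[\cdot,\cdot])$ is a Krein space with fundamental symmetry $J\upharpoonright_{\mathfrak{M}}$. A subspace $\mathfrak{M}_1\subset\mathfrak{M}$ is called hypermaximal neutral if $\mathfrak{M}=\mathfrak{M}_1\oplus J\mathfrak{M}_1$ (orthogonal sum with respect to $(\cdot,\cdot)$). For dual maximal definite subspaces $\mathfrak{L}^{max}_\pm$, the associated Hilbert space $(\mathfrak{H}_G,(\cdot,\cdot)_G)$ is the completion of $\mathcal{D}_{max}=\mathfrak{L}_+^{max}+\mathfrak{L}_-^{max}$ with respect to the inner product $(f,g)_G=[f_+,g_+]-[f_-,g_-]$, where $f=f_++f_-$, $g=g_++g_-$, $f_\pm,g_\pm\in\mathfrak{L}_\pm^{max}$. *)

theory Defs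
  imports "HOL-Analysis.Analysis"
begin

section \<open>Complex Hilbert spaces\<close>

text \<open>The library has only real inner product spaces. A complex one is a real one with a complex
  scalar multiplication and a complex inner product whose real part is the given real inner
  product; hence norm, metric and topology are those of the library.
  The complex inner product is linear in the first argument.\<close>

class complex_inner = real_inner +
  fixes scaleC :: "complex \<Rightarrow> 'a \<Rightarrow> 'a"  (infixr \<open>*\<^sub>C\<close> 75)
    and cinner :: "'a \<Rightarrow> 'a \<Rightarrow> complex"
  assumes scaleC_add_right: "a *\<^sub>C (x + y) = a *\<^sub>C x + a *\<^sub>C y"
    and scaleC_add_left: "(a + b) *\<^sub>C x = a *\<^sub>C x + b *\<^sub>C x"
    and scaleC_scaleC: "a *\<^sub>C (b *\<^sub>C x) = (a * b) *\<^sub>C x"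
    and scaleC_of_real: "complex_of_real r *\<^sub>C x = r *\<^sub>R x"
    and cinner_commute: "cinner x y = cnj (cinner y x)"
    and cinner_add_left: "cinner (x + y) z = cinner x z + cinner y z"
    and cinner_scaleC_left: "cinner (a *\<^sub>C x) y = a * cinner x y"
    and Re_cinner: "Re (cinner x y) = inner x y"

class chilbert_space = complex_inner + complete_space

interpretation complex_vector: vector_space "scaleC :: complex \<Rightarrow> 'a \<Rightarrow> 'a::complex_inner"
proof
  show "1 *\<^sub>C x = x" for x :: 'a
    using scaleC_of_real[of 1 x] by simp
qed (simp_all add: scaleC_add_right scaleC_add_left scaleC_scaleC)

definition closed_csubspace :: "'a::complex_inner set \<Rightarrow> bool" where
  "closed_csubspace S \<longleftrightarrow> module.subspace scaleC S \<and> closed S"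

definition bounded_clinear :: "('a::complex_inner \<Rightarrow> 'a) \<Rightarrow> bool" where
  "bounded_clinear T \<longleftrightarrow> Vector_Spaces.linear scaleC scaleC T \<and> bounded_linear T"

definition selfadjoint :: "('a::complex_inner \<Rightarrow> 'a) \<Rightarrow> bool" where
  "selfadjoint T \<longleftrightarrow> bounded_clinear T \<and> (\<forall>x y. cinner (T x) y = cinner x (T y))"

text \<open>\<open>(T x, x)\<close> is real for self-adjoint \<open>T\<close>, so taking real parts loses nothing below.\<close>

definition op_le :: "('a::complex_inner \<Rightarrow> 'a) \<Rightarrow> ('a \<Rightarrow> 'a) \<Rightarrow> bool" where
  "op_le A B \<longleftrightarrow> (\<forall>x. Re (cinner (A x) x) \<le> Re (cinner (B x) x))"

definition operator_interval ::
    "('a::complex_inner \<Rightarrow> 'a) \<Rightarrow> ('a \<Rightarrow> 'a) \<Rightarrow> ('a \<Rightarrow> 'a) set" where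
  "operator_interval A B = {T. selfadjoint T \<and> op_le A T \<and> op_le T B}"

definition alg_sum :: "'a::plus set \<Rightarrow> 'a set \<Rightarrow> 'a set" where
  "alg_sum A B = {x + y | x y. x \<in> A \<and> y \<in> B}"


section \<open>Krein spaces and dual definite subspaces\<close>

definition fundamental_symmetry :: "('a::complex_inner \<Rightarrow> 'a) \<Rightarrow> bool" where
  "fundamental_symmetry J \<longleftrightarrow>
     selfadjoint J \<and> J \<circ> J = id \<and> J \<noteq> id \<and> J \<noteq> (\<lambda>x. - x)"

definition indef :: "('a::complex_inner \<Rightarrow> 'a) \<Rightarrow> 'a \<Rightarrow> 'a \<Rightarrow> complex" where
  "indef J f g = cinner (J f) g"

definition P_plus :: "('a::complex_inner \<Rightarrow> 'a) \<Rightarrow> 'a \<Rightarrow> 'a" where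
  "P_plus J x = (1/2) *\<^sub>R (x + J x)"

definition P_minus :: "('a::complex_inner \<Rightarrow> 'a) \<Rightarrow> 'a \<Rightarrow> 'a" where
  "P_minus J x = (1/2) *\<^sub>R (x - J x)"

text \<open>\<open>[f, f]\<close> is real since \<open>J\<close> is self-adjoint.\<close>

definition positive_subspace :: "('a::complex_inner \<Rightarrow> 'a) \<Rightarrow> 'a set \<Rightarrow> bool" where
  "positive_subspace J L \<longleftrightarrow>
     closed_csubspace L \<and> (\<forall>f\<in>L. f \<noteq> 0 \<longrightarrow> Re (indef J f f) > 0)"

definition negative_subspace :: "('a::complex_inner \<Rightarrow> 'a) \<Rightarrow> 'a set \<Rightarrow> bool" where
  "negative_subspace J L \<longleftrightarrow>
     closed_csubspace L \<and> (\<forall>f\<in>L. f \<noteq> 0 \<longrightarrow> Re (indef J f f) < 0)"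

definition maximal_positive :: "('a::complex_inner \<Rightarrow> 'a) \<Rightarrow> 'a set \<Rightarrow> bool" where
  "maximal_positive J L \<longleftrightarrow>
     positive_subspace J L \<and> (\<nexists>L'. positive_subspace J L' \<and> L \<subset> L')"

definition maximal_negative :: "('a::complex_inner \<Rightarrow> 'a) \<Rightarrow> 'a set \<Rightarrow> bool" where
  "maximal_negative J L \<longleftrightarrow>
     negative_subspace J L \<and> (\<nexists>L'. negative_subspace J L' \<and> L \<subset> L')"

definition dual_definite :: "('a::complex_inner \<Rightarrow> 'a) \<Rightarrow> 'a set \<Rightarrow> 'a set \<Rightarrow> bool" where
  "dual_definite J Lpos Lneg \<longleftrightarrow>
     positive_subspace J Lpos \<and> negative_subspace J Lneg \<and> (\<forall>f\<in>Lpos. \<forall>g\<in>Lneg. indef J f g = 0)"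

definition dual_maximal_definite :: "('a::complex_inner \<Rightarrow> 'a) \<Rightarrow> 'a set \<Rightarrow> 'a set \<Rightarrow> bool" where
  "dual_maximal_definite J Lpos Lneg \<longleftrightarrow>
     dual_definite J Lpos Lneg \<and> maximal_positive J Lpos \<and> maximal_negative J Lneg"

definition hypermaximal_neutral ::
    "('a::complex_inner \<Rightarrow> 'a) \<Rightarrow> 'a set \<Rightarrow> 'a set \<Rightarrow> bool" where
  "hypermaximal_neutral J M M1 \<longleftrightarrow>
     closed_csubspace M1 \<and> M1 \<subseteq> M \<and>
     M = alg_sum M1 (J ` M1) \<and> (\<forall>x\<in>M1. \<forall>y\<in>J ` M1. cinner x y = 0)"


section \<open>The associated operator and its self-adjoint contractive extensions\<close>

text \<open>The representations \<open>Lpos = {x + Kp x | x \<in> Mp}\<close> and \<open>Lneg = {x + Kn x | x \<in> Mn}\<close>, with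
  \<open>Mp\<close>, \<open>range Kn\<close> in the range of \<open>P_plus J\<close> and \<open>Mn\<close>, \<open>range Kp\<close> in that of \<open>P_minus J\<close>,
  force \<open>Mp\<close> and \<open>Mn\<close> to be the projections of \<open>Lpos\<close> and \<open>Lneg\<close>, and determine
  \<open>Kp\<close> on \<open>Mp\<close> and \<open>Kn\<close> on \<open>Mn\<close>. The values elsewhere are irrelevant.\<close>

definition M_plus :: "('a::complex_inner \<Rightarrow> 'a) \<Rightarrow> 'a set \<Rightarrow> 'a set" where
  "M_plus J Lpos = P_plus J ` Lpos"

definition M_minus :: "('a::complex_inner \<Rightarrow> 'a) \<Rightarrow> 'a set \<Rightarrow> 'a set" where
  "M_minus J Lneg = P_minus J ` Lneg"

definition K_plus :: "('a::complex_inner \<Rightarrow> 'a) \<Rightarrow> 'a set \<Rightarrow> 'a \<Rightarrow> 'a" where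
  "K_plus J Lpos x = (THE y. y \<in> range (P_minus J) \<and> x + y \<in> Lpos)"

definition K_minus :: "('a::complex_inner \<Rightarrow> 'a) \<Rightarrow> 'a set \<Rightarrow> 'a \<Rightarrow> 'a" where
  "K_minus J Lneg x = (THE y. y \<in> range (P_plus J) \<and> x + y \<in> Lneg)"

definition T0_op :: "('a::complex_inner \<Rightarrow> 'a) \<Rightarrow> 'a set \<Rightarrow> 'a set \<Rightarrow> 'a \<Rightarrow> 'a" where
  "T0_op J Lpos Lneg x = K_plus J Lpos (P_plus J x) + K_minus J Lneg (P_minus J x)"

definition T0_dom :: "('a::complex_inner \<Rightarrow> 'a) \<Rightarrow> 'a set \<Rightarrow> 'a set \<Rightarrow> 'a set" where
  "T0_dom J Lpos Lneg = alg_sum (M_plus J Lpos) (M_minus J Lneg)"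

definition sa_contractive_extensions ::
    "('a::complex_inner \<Rightarrow> 'a) \<Rightarrow> 'a set \<Rightarrow> 'a set \<Rightarrow> ('a \<Rightarrow> 'a) set" where
  "sa_contractive_extensions J Lpos Lneg =
     {T. selfadjoint T \<and> (\<forall>x. norm (T x) \<le> norm x) \<and>
         (\<forall>x\<in>T0_dom J Lpos Lneg. T x = T0_op J Lpos Lneg x)}"

text \<open>The set of these extensions is a nonempty operator interval, and the end points of a
  nonempty operator interval are unique.\<close>

definition extension_endpoints ::
    "('a::complex_inner \<Rightarrow> 'a) \<Rightarrow> 'a set \<Rightarrow> 'a set \<Rightarrow> ('a \<Rightarrow> 'a) \<times> ('a \<Rightarrow> 'a)" where
  "extension_endpoints J Lpos Lneg =
     (THE (A, B). selfadjoint A \<and> selfadjoint B \<and>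
        sa_contractive_extensions J Lpos Lneg = operator_interval A B)"

definition T_mu :: "('a::complex_inner \<Rightarrow> 'a) \<Rightarrow> 'a set \<Rightarrow> 'a set \<Rightarrow> 'a \<Rightarrow> 'a" where
  "T_mu J Lpos Lneg = fst (extension_endpoints J Lpos Lneg)"

definition T_M :: "('a::complex_inner \<Rightarrow> 'a) \<Rightarrow> 'a set \<Rightarrow> 'a set \<Rightarrow> 'a \<Rightarrow> 'a" where
  "T_M J Lpos Lneg = snd (extension_endpoints J Lpos Lneg)"

definition M_space :: "('a::complex_inner \<Rightarrow> 'a) \<Rightarrow> 'a set \<Rightarrow> 'a set \<Rightarrow> 'a set" where
  "M_space J Lpos Lneg = closure (range (\<lambda>x. T_M J Lpos Lneg x - T_mu J Lpos Lneg x))"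


section \<open>Completion of an inner product space\<close>

text \<open>For an inner product \<open>g\<close> on a linear subspace \<open>S\<close>, unrelated to the topology of the ambient
  type, the completion consists of the \<open>g\<close>-Cauchy sequences in \<open>S\<close> modulo \<open>g\<close>-null sequences.\<close>

definition ip_norm :: "('a \<Rightarrow> 'a \<Rightarrow> complex) \<Rightarrow> 'a \<Rightarrow> real" where
  "ip_norm g f = sqrt (Re (g f f))"

definition cauchy_seqs :: "'a::ab_group_add set \<Rightarrow> ('a \<Rightarrow> 'a \<Rightarrow> complex) \<Rightarrow> (nat \<Rightarrow> 'a) set" where
  "cauchy_seqs S g =
     {X. range X \<subseteq> S \<and> (\<forall>e>0. \<exists>N. \<forall>m\<ge>N. \<forall>n\<ge>N. ip_norm g (X m - X n) < e)}"

definition null_rel ::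
    "'a::ab_group_add set \<Rightarrow> ('a \<Rightarrow> 'a \<Rightarrow> complex) \<Rightarrow> ((nat \<Rightarrow> 'a) \<times> (nat \<Rightarrow> 'a)) set" where
  "null_rel S g =
     {(X, Y). X \<in> cauchy_seqs S g \<and> Y \<in> cauchy_seqs S g \<and>
        (\<lambda>n. ip_norm g (X n - Y n)) \<longlonglongrightarrow> 0}"

definition completion ::
    "'a::ab_group_add set \<Rightarrow> ('a \<Rightarrow> 'a \<Rightarrow> complex) \<Rightarrow> (nat \<Rightarrow> 'a) set set" where
  "completion S g = cauchy_seqs S g // null_rel S g"

definition compl_embed ::
    "'a::ab_group_add set \<Rightarrow> ('a \<Rightarrow> 'a \<Rightarrow> complex) \<Rightarrow> 'a \<Rightarrow> (nat \<Rightarrow> 'a) set" where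
  "compl_embed S g f = null_rel S g `` {\<lambda>n. f}"

definition compl_diff ::
    "'a::ab_group_add set \<Rightarrow> ('a \<Rightarrow> 'a \<Rightarrow> complex) \<Rightarrow>
       (nat \<Rightarrow> 'a) set \<Rightarrow> (nat \<Rightarrow> 'a) set \<Rightarrow> (nat \<Rightarrow> 'a) set" where
  "compl_diff S g A B = (\<Union>X\<in>A. \<Union>Y\<in>B. null_rel S g `` {\<lambda>n. X n - Y n})"

definition compl_inner ::
    "('a \<Rightarrow> 'a \<Rightarrow> complex) \<Rightarrow> (nat \<Rightarrow> 'a) set \<Rightarrow> (nat \<Rightarrow> 'a) set \<Rightarrow> complex" where
  "compl_inner g A B = (THE z. \<forall>X\<in>A. \<forall>Y\<in>B. (\<lambda>n. g (X n) (Y n)) \<longlonglongrightarrow> z)"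

definition dense_in_completion ::
    "'a::ab_group_add set \<Rightarrow> ('a \<Rightarrow> 'a \<Rightarrow> complex) \<Rightarrow> 'a set \<Rightarrow> bool" where
  "dense_in_completion S g D \<longleftrightarrow>
     (\<forall>A\<in>completion S g. \<forall>e>0. \<exists>f\<in>D.
        ip_norm (compl_inner g) (compl_diff S g A (compl_embed S g f)) < e)"


section \<open>The Hilbert space associated with dual maximal definite subspaces\<close>

text \<open>Dual definite subspaces meet only in \<open>0\<close>, so the components are unique on their sum.\<close>

definition comp_plus :: "'a::complex_inner set \<Rightarrow> 'a set \<Rightarrow> 'a \<Rightarrow> 'a" where
  "comp_plus Lpos Lneg f = (THE u. u \<in> Lpos \<and> f - u \<in> Lneg)"

definition comp_minus :: "'a::complex_inner set \<Rightarrow> 'a set \<Rightarrow> 'a \<Rightarrow> 'a" where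
  "comp_minus Lpos Lneg f = f - comp_plus Lpos Lneg f"

definition G_inner ::
    "('a::complex_inner \<Rightarrow> 'a) \<Rightarrow> 'a set \<Rightarrow> 'a set \<Rightarrow> 'a \<Rightarrow> 'a \<Rightarrow> complex" where
  "G_inner J Lpos Lneg f g =
     indef J (comp_plus Lpos Lneg f) (comp_plus Lpos Lneg g)
     - indef J (comp_minus Lpos Lneg f) (comp_minus Lpos Lneg g)"

definition dense_in_HG ::
    "('a::complex_inner \<Rightarrow> 'a) \<Rightarrow> 'a set \<Rightarrow> 'a set \<Rightarrow> 'a set \<Rightarrow> bool" where
  "dense_in_HG J Lpos Lneg D \<longleftrightarrow> dense_in_completion (alg_sum Lpos Lneg) (G_inner J Lpos Lneg) D"

definition dual_maximal_extensions ::
    "('a::complex_inner \<Rightarrow> 'a) \<Rightarrow> 'a set \<Rightarrow> 'a set \<Rightarrow> ('a set \<times> 'a set) set" where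
  "dual_maximal_extensions J Lpos Lneg =
     {(Lpos', Lneg'). dual_maximal_definite J Lpos' Lneg' \<and> Lpos \<subseteq> Lpos' \<and> Lneg \<subseteq> Lneg'}"

end

theory Submission
  imports Defs
begin

text \<open>
  For a self-adjoint contractive extension \<open>T\<close> of \<open>T0\<close> with \<open>J T = - T J\<close>, the subspaces
  \<open>(1 + T) H\<^sub>+\<close> and \<open>(1 + T) H\<^sub>-\<close> are dual, maximal definite and extend \<open>Lpos\<close> and \<open>Lneg\<close>: density of
  \<open>Lpos + Lneg = (1 + T0) dom0\<close> makes \<open>T\<close> a strong contraction, and a positive subspace that projects
  onto all of \<open>H\<^sub>+\<close> is maximal. Distinct \<open>T\<close> give distinct pairs. The squared norm of \<open>(1 + T) x\<close> in the
  associated Hilbert space is the energy \<open>\<parallel>x\<parallel>\<^sup>2 - \<parallel>T x\<parallel>\<^sup>2\<close>, so \<open>Lpos + Lneg\<close> is dense there iff the energy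
  of \<open>x - y\<close> has infimum \<open>0\<close> over \<open>y\<close> in the domain \<open>dom0\<close> of \<open>T0\<close>, for every \<open>x\<close> (\<open>dense_in_HG_iff\<close>).

  This infimum is computed from two facts. The endpoint \<open>T\<^sub>\<mu>\<close> is the smallest extension, which says that
  the form of \<open>1 + T\<^sub>\<mu>\<close> at \<open>x - y\<close> has infimum \<open>0\<close> over \<open>y \<in> dom0\<close>; reflection by \<open>J\<close> gives the same for
  \<open>1 - T\<^sub>M\<close> (\<open>smallest_positive_extension\<close>, \<open>T_mu_infimum\<close>, \<open>T_M_infimum\<close>). And \<open>(1 - T\<^sup>2) / 2\<close> is the
  parallel sum of \<open>1 + T\<close> and \<open>1 - T\<close> (\<open>energy_parallel_sum\<close>). Together they show that the infimum is twice
  the parallel sum of \<open>T - T\<^sub>\<mu>\<close> and \<open>T\<^sub>M - T\<close> at \<open>x\<close>.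

  Let \<open>R\<close> be a self-adjoint square root of \<open>T\<^sub>M - T\<^sub>\<mu>\<close> that commutes with \<open>J\<close> (\<open>positive_sqrt\<close>); its range
  is dense in \<open>M\<close>. Write \<open>T = (T\<^sub>\<mu> + T\<^sub>M) / 2 + R Z R / 2\<close> with \<open>Z\<close> self-adjoint on \<open>M\<close>, \<open>Z J = - J Z\<close> and
  \<open>\<parallel>Z\<parallel> \<le> 1\<close>. Then \<open>T\<close> is an extension anticommuting with \<open>J\<close>, and up to a factor the parallel sum above
  is that of \<open>1 + Z\<close> and \<open>1 - Z\<close> at \<open>R x\<close>. It vanishes if \<open>Z\<^sup>2 = 1\<close> (\<open>dense_if_unitary\<close>), whereas it is
  bounded below by a positive multiple of \<open>\<parallel>R x\<parallel>\<^sup>2\<close> if \<open>\<parallel>Z\<parallel> < 1\<close> (\<open>not_dense_if_strict\<close>).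

  A hypermaximal neutral subspace \<open>M1\<close> supplies such operators: let \<open>X\<close> (\<open>sgn_M\<close>) be \<open>1\<close> on \<open>M1\<close>
  and \<open>-1\<close> on \<open>J M1\<close>. Both \<open>X\<close> and \<open>\<i> J X\<close> are self-adjoint, square to the identity of \<open>M\<close>, and anticommute with \<open>J\<close>
  and with each other, so \<open>Z = a X + b \<i> J X\<close> (\<open>rot_sgn a b\<close>) has \<open>Z\<^sup>2 = a\<^sup>2 + b\<^sup>2\<close> on \<open>M\<close>. The circle \<open>a\<^sup>2 + b\<^sup>2 = 1\<close> gives
  the first infinite family and the segment \<open>0 \<le> a < 1\<close>, \<open>b = 0\<close> the second.
\<close>

section \<open>Self-adjoint operators and their quadratic forms\<close>

instance chilbert_space \<subseteq> banach ..

abbreviation mult_i :: "'a::complex_inner \<Rightarrow> 'a" where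
  "mult_i x \<equiv> \<i> *\<^sub>C x"

lemma scaleC_Complex: "a *\<^sub>C x = Re a *\<^sub>R x + Im a *\<^sub>R mult_i (x::'a::complex_inner)"
proof -
  have "a *\<^sub>C x = (complex_of_real (Re a) + complex_of_real (Im a) * \<i>) *\<^sub>C x"
    by (metis complex_eq mult.commute)
  then show ?thesis by (simp only: scaleC_add_left flip: scaleC_scaleC scaleC_of_real)
qed

lemma mult_i_simps [simp]:
  fixes x y :: "'a::complex_inner"
  shows "mult_i (x + y) = mult_i x + mult_i y" "mult_i (mult_i x) = - x"
    "mult_i (r *\<^sub>R x) = r *\<^sub>R mult_i x" "mult_i (- x) = - mult_i x"
    "mult_i (x - y) = mult_i x - mult_i y" "mult_i (0::'a) = 0"
proof -
  show r: "mult_i (r *\<^sub>R x) = r *\<^sub>R mult_i x" for r x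
    by (simp add: scaleC_scaleC mult.commute flip: scaleC_of_real)
  show "mult_i (mult_i x) = - x"
    using scaleC_of_real[of "-1" x] by (simp add: scaleC_scaleC)
  show m: "mult_i (- x) = - mult_i x" for x :: 'a using r[of "-1" x] by simp
  show a: "mult_i (x + y) = mult_i x + mult_i y" for x y :: 'a by (rule scaleC_add_right)
  show "mult_i (x - y) = mult_i x - mult_i y" using a[of x "-y"] m[of y] by simp
  show "mult_i (0::'a) = 0" using r[of 0 0] by simp
qed

lemma inner_mult_i_mult_i [simp]: "inner (mult_i x) (mult_i y) = inner x (y::'a::complex_inner)"
proof -
  have "cinner (mult_i x) (mult_i y) = \<i> * cnj (\<i> * cinner y x)"
    by (metis cinner_commute cinner_scaleC_left)
  also have "\<dots> = cinner x y" using cinner_commute[of x y] by simp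
  finally show ?thesis by (metis Re_cinner)
qed

lemma inner_mult_i_left: "inner (mult_i x) y = - inner x (mult_i (y::'a::complex_inner))"
  using inner_mult_i_mult_i[of x "mult_i y"] by simp

lemma inner_mult_i_self [simp]: "inner x (mult_i (x::'a::complex_inner)) = 0" "inner (mult_i x) x = 0"
  using inner_mult_i_left[of x x] by (simp_all add: inner_commute)

lemma Im_cinner: "Im (cinner x y) = inner x (mult_i (y::'a::complex_inner))"
proof -
  have "inner (mult_i x) y = Re (\<i> * cinner x y)" by (metis Re_cinner cinner_scaleC_left)
  then show ?thesis by (simp add: inner_mult_i_left)
qed

lemma norm_mult_i [simp]: "norm (mult_i x) = norm (x::'a::complex_inner)"
  by (simp add: norm_eq_sqrt_inner)

lemma bounded_linear_mult_i: "bounded_linear (mult_i :: 'a \<Rightarrow> 'a::complex_inner)"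
  by (rule bounded_linear_intro[where K = 1]) simp_all

text \<open>Only commutation with \<open>\<i>\<close> separates complex from real self-adjointness, which lets
  everything below be done with the real inner product.\<close>

lemma selfadjoint_iff:
  fixes T :: "'a::complex_inner \<Rightarrow> 'a"
  shows "selfadjoint T \<longleftrightarrow> bounded_linear T \<and> (\<forall>x. T (mult_i x) = mult_i (T x)) \<and>
    (\<forall>x y. inner (T x) y = inner x (T y))" (is "?l \<longleftrightarrow> ?r")
proof
  assume l: ?l
  then have lin: "Vector_Spaces.linear scaleC scaleC T" and b: "bounded_linear T"
    and s: "\<And>x y. cinner (T x) y = cinner x (T y)"
    by (auto simp: selfadjoint_def bounded_clinear_def)
  interpret Vector_Spaces.linear scaleC scaleC T by (rule lin)
  show ?r using b s scale by (metis Re_cinner)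
next
  assume r: ?r
  interpret bounded_linear T using r by blast
  have "T (a *\<^sub>C x) = a *\<^sub>C T x" for a x
    using r by (simp add: scaleC_Complex[of a] add scaleR)
  then have "Vector_Spaces.linear scaleC scaleC T"
    by (simp add: Vector_Spaces.linear_iff complex_vector.vector_space_axioms add)
  moreover have "cinner (T x) y = cinner x (T y)" for x y
    using r by (intro complex_eqI) (auto simp: Im_cinner Re_cinner)
  ultimately show ?l using r by (auto simp: selfadjoint_def bounded_clinear_def)
qed

lemma selfadjointD:
  fixes T :: "'a::complex_inner \<Rightarrow> 'a"
  assumes "selfadjoint T"
  shows "bounded_linear T" "T (mult_i x) = mult_i (T x)" "inner (T x) y = inner x (T y)"
    "T (x + y) = T x + T y" "T (x - y) = T x - T y" "T (- x) = - T x" "T 0 = 0"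
    "T (r *\<^sub>R x) = r *\<^sub>R T x"
proof -
  show b: "bounded_linear T" "T (mult_i x) = mult_i (T x)" "inner (T x) y = inner x (T y)"
    using assms by (auto simp: selfadjoint_iff)
  interpret bounded_linear T by (rule b)
  show "T (x + y) = T x + T y" "T (x - y) = T x - T y" "T (- x) = - T x" "T 0 = 0"
    "T (r *\<^sub>R x) = r *\<^sub>R T x" by (simp_all add: add diff neg zero scaleR)
qed

lemma op_le_iff: "op_le A B \<longleftrightarrow> (\<forall>x. inner (A x) x \<le> inner (B x) x)"
  by (simp add: op_le_def Re_cinner)

lemma selfadjoint_id: "selfadjoint (\<lambda>x::'a::complex_inner. x)"
  by (simp add: selfadjoint_iff)

lemma selfadjoint_add:
  "selfadjoint A \<Longrightarrow> selfadjoint B \<Longrightarrow> selfadjoint (\<lambda>x. A x + B x :: 'a::complex_inner)"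
  by (simp add: selfadjoint_iff bounded_linear_add inner_add)

lemma selfadjoint_diff:
  "selfadjoint A \<Longrightarrow> selfadjoint B \<Longrightarrow> selfadjoint (\<lambda>x. A x - B x :: 'a::complex_inner)"
  by (simp add: selfadjoint_iff bounded_linear_sub inner_diff)

lemma selfadjoint_scaleR:
  "selfadjoint A \<Longrightarrow> selfadjoint (\<lambda>x. r *\<^sub>R A x :: 'a::complex_inner)"
  by (simp add: selfadjoint_iff bounded_linear_scaleR_right bounded_linear_compose[OF bounded_linear_scaleR_right])

lemma selfadjoint_sandwich:
  assumes "selfadjoint A" "selfadjoint B"
  shows "selfadjoint (\<lambda>x. A (B (A x)) :: 'a::complex_inner)"
  using assms
  by (auto simp: selfadjoint_iff bounded_linear_compose[of A] bounded_linear_compose[of B])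

lemma closed_csubspaceD:
  assumes "closed_csubspace (S :: 'a::complex_inner set)"
  shows "0 \<in> S" "x \<in> S \<Longrightarrow> y \<in> S \<Longrightarrow> x + y \<in> S" "x \<in> S \<Longrightarrow> y \<in> S \<Longrightarrow> x - y \<in> S"
    "x \<in> S \<Longrightarrow> r *\<^sub>R x \<in> S" "x \<in> S \<Longrightarrow> mult_i x \<in> S" "closed S" "subspace S"
proof -
  have S: "complex_vector.subspace S" "closed S" using assms by (auto simp: closed_csubspace_def)
  then show "0 \<in> S" "x \<in> S \<Longrightarrow> y \<in> S \<Longrightarrow> x + y \<in> S" "x \<in> S \<Longrightarrow> y \<in> S \<Longrightarrow> x - y \<in> S"
    "x \<in> S \<Longrightarrow> mult_i x \<in> S" "closed S"
    by (auto simp: complex_vector.subspace_def complex_vector.subspace_diff)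
  show r: "r *\<^sub>R x \<in> S" if "x \<in> S" for r x
    using S(1) that by (metis complex_vector.subspace_scale scaleC_of_real)
  show "subspace S"
    using S(1) r by (auto simp: subspace_def complex_vector.subspace_def)
qed

lemma fixed_point_subspace:
  assumes A: "bounded_linear A" "\<And>x. A (mult_i x) = mult_i (A x)"
  shows "closed_csubspace {f::'a::complex_inner. A f = f}"
proof -
  interpret bounded_linear A by (rule A)
  have "closed {f. A f = f}" by (intro closed_Collect_eq continuous_on continuous_on_id)
  moreover have "A (c *\<^sub>C f) = c *\<^sub>C f" if "A f = f" for c f
    using that by (simp add: scaleC_Complex[of c] add scaleR A(2))
  ultimately show ?thesis
    by (simp add: closed_csubspace_def complex_vector.subspace_def zero add)
qed

lemma quadratic_nonneg_discriminant:
  fixes a b c :: real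
  assumes "\<And>t. 0 \<le> a + 2 * t * b + t^2 * c"
  shows "b^2 \<le> a * c"
proof (cases "c = 0")
  case True
  have "b = 0"
  proof (rule ccontr)
    assume "b \<noteq> 0"
    then show False using assms[of "- (a + 1) / (2 * b)"] True by (simp add: field_simps)
  qed
  then show ?thesis using True by simp
next
  case False
  moreover have "c \<ge> 0"
  proof (rule ccontr)
    assume "\<not> c \<ge> 0"
    then have c: "c < 0" by simp
    define u t where "u = \<bar>a\<bar> + 2 * \<bar>b\<bar> + 1" and "t = u / - c + 1"
    have t1: "t \<ge> 1" using c by (simp add: t_def u_def divide_nonneg_neg)
    have "t * c = c - u" using c by (simp add: t_def field_simps)
    then have "2 * b + t * c \<le> - \<bar>a\<bar> - 1" using c by (simp add: u_def)
    then have "t * (2 * b + t * c) \<le> t * (- \<bar>a\<bar> - 1)" using t1 by (intro mult_left_mono) auto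
    moreover have "t * (- \<bar>a\<bar> - 1) \<le> 1 * (- \<bar>a\<bar> - 1)" using t1 by (intro mult_right_mono_neg) auto
    ultimately show False using assms[of t] by (simp add: algebra_simps power2_eq_square)
  qed
  ultimately have "c > 0" by simp
  then show ?thesis using assms[of "- b / c"] by (simp add: field_simps power2_eq_square)
qed

lemma positive_Cauchy_Schwarz:
  fixes A :: "'a::complex_inner \<Rightarrow> 'a"
  assumes "selfadjoint A" "\<And>x. 0 \<le> inner (A x) x"
  shows "(inner (A x) y)^2 \<le> inner (A x) x * inner (A y) y"
proof (rule quadratic_nonneg_discriminant)
  fix t
  have "0 \<le> inner (A (x + t *\<^sub>R y)) (x + t *\<^sub>R y)" by (rule assms)
  also have "\<dots> = inner (A x) x + 2 * t * inner (A x) y + t^2 * inner (A y) y"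
    using selfadjointD(3)[OF assms(1), of y x]
    by (simp add: selfadjointD[OF assms(1)] inner_add algebra_simps power2_eq_square inner_commute)
  finally show "0 \<le> inner (A x) x + 2 * t * inner (A x) y + t^2 * inner (A y) y" .
qed

lemma positive_form_zero:
  fixes A :: "'a::complex_inner \<Rightarrow> 'a"
  assumes "selfadjoint A" "\<And>x. 0 \<le> inner (A x) x" "inner (A x) x = 0"
  shows "A x = 0"
  using positive_Cauchy_Schwarz[OF assms(1,2), of x "A x"] assms(3) by simp

lemma contraction_form_bound:
  assumes "norm (T x) \<le> norm (x::'a::real_inner)"
  shows "\<bar>inner (T x) x\<bar> \<le> (norm x)^2"
  using Cauchy_Schwarz_ineq2[of "T x" x] mult_right_mono[OF assms, of "norm x"]
  by (simp add: power2_eq_square)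

text \<open>Differences of extensions of one operator vanish on its domain, so their forms do not see shifts
  along the domain.\<close>

lemma form_shift:
  assumes "selfadjoint C" "C y = (0::'a::complex_inner)"
  shows "inner (C (x - y)) (x - y) = inner (C x) x"
  using selfadjointD(3)[OF assms(1), of x y] assms(2)
  by (simp add: selfadjointD(5)[OF assms(1)] inner_diff)

lemma op_le_antisym:
  fixes A B :: "'a::complex_inner \<Rightarrow> 'a"
  assumes "selfadjoint A" "selfadjoint B" "op_le A B" "op_le B A"
  shows "A = B"
proof
  fix x
  have "B x - A x = 0"
    using assms by (intro positive_form_zero[where A = "\<lambda>x. B x - A x"] selfadjoint_diff)
      (auto simp: op_le_iff inner_diff_left antisym)
  then show "A x = B x" by simp
qed

lemma selfadjoint_contraction:
  fixes T :: "'a::complex_inner \<Rightarrow> 'a"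
  assumes "selfadjoint T" "\<And>x. \<bar>inner (T x) x\<bar> \<le> (norm x)^2"
  shows "norm (T x) \<le> norm x"
proof (cases "T x = 0")
  case False
  have x: "x \<noteq> 0" using False selfadjointD(7)[OF assms(1)] by auto
  define y where "y = (norm x / norm (T x)) *\<^sub>R T x"
  have ny: "norm y = norm x" using False by (simp add: y_def)
  have "4 * inner (T x) y = inner (T (x + y)) (x + y) - inner (T (x - y)) (x - y)"
    using selfadjointD(3)[OF assms(1), of y x]
    by (simp add: selfadjointD[OF assms(1)] inner_add inner_diff algebra_simps inner_commute)
  also have "\<dots> \<le> (norm (x + y))^2 + (norm (x - y))^2"
    using assms(2)[of "x + y"] assms(2)[of "x - y"] by linarith
  also have "\<dots> = 4 * (norm x)^2"
    using arg_cong[OF ny, of "\<lambda>r. r^2"] by (simp add: power2_norm_eq_inner inner_add inner_diff)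
  finally have "inner (T x) y \<le> (norm x)^2" by simp
  moreover have "inner (T x) y = norm x * norm (T x)"
    using False by (simp add: y_def power2_norm_eq_inner[symmetric] power2_eq_square)
  ultimately show ?thesis using x by (simp add: power2_eq_square)
qed simp

lemma operator_interval_endpoints_unique:
  fixes A B A' B' :: "'a::complex_inner \<Rightarrow> 'a"
  assumes sa: "selfadjoint A" "selfadjoint B" "selfadjoint A'" "selfadjoint B'"
    and eq: "operator_interval A B = operator_interval A' B'" and ne: "operator_interval A B \<noteq> {}"
  shows "A' = A" "B' = B"
proof -
  have ends: "U \<in> operator_interval U V" "V \<in> operator_interval U V"
    if "selfadjoint U" "selfadjoint V" "operator_interval U V \<noteq> {}" for U V :: "'a \<Rightarrow> 'a"
  proof -
    from that(3) have "op_le U V" by (auto simp: operator_interval_def op_le_iff intro: order_trans)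
    then show "U \<in> operator_interval U V" "V \<in> operator_interval U V"
      using that by (auto simp: operator_interval_def op_le_iff)
  qed
  have "A \<in> operator_interval A' B'" "B \<in> operator_interval A' B'"
    using ends[OF sa(1,2) ne] eq by auto
  moreover have "A' \<in> operator_interval A B" "B' \<in> operator_interval A B"
    using ends[OF sa(3,4)] ne eq by auto
  ultimately show "A' = A" "B' = B"
    using sa by (auto intro!: op_le_antisym simp: operator_interval_def)
qed

section \<open>Orthogonal projection and bounded quadratic forms\<close>

text \<open>With \<open>f = inner x\<close> this is the orthogonal projection onto \<open>S\<close>; with \<open>S = UNIV\<close> it is the
  Riesz representation. The representing vector minimises \<open>\<parallel>y\<parallel>\<^sup>2 - 2 f y\<close> over \<open>S\<close>;
  the parallelogram law makes every minimising sequence a Cauchy sequence.\<close>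

lemma Riesz_on_closed_subspace:
  fixes S :: "'a::{real_inner, complete_space} set"
  assumes S: "subspace S" "closed S" and f: "bounded_linear f"
  shows "\<exists>p\<in>S. \<forall>w\<in>S. inner p w = f w"
proof -
  interpret f: bounded_linear f by (rule f)
  obtain K where K: "\<And>x. norm (f x) \<le> norm x * K" using f.bounded by blast
  define F where "F y = (norm y)^2 - 2 * f y" for y
  have F_lower: "- (K^2) \<le> F y" for y
  proof -
    have "f y \<le> norm y * K" using K[of y] by simp
    moreover have "0 \<le> (norm y - K)^2" by simp
    ultimately show ?thesis by (simp add: F_def power2_eq_square algebra_simps)
  qed
  define m where "m = (INF y\<in>S. F y)"
  have bdd: "bdd_below (F ` S)" using F_lower by (rule bdd_belowI2)
  have m_le: "m \<le> F y" if "y \<in> S" for y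
    unfolding m_def using bdd that by (rule cINF_lower)
  have "\<exists>y\<in>S. F y < m + 1 / real (Suc n)" for n
  proof -
    have "S \<noteq> {}" using subspace_0[OF S(1)] by blast
    moreover have "m < m + 1 / real (Suc n)" by simp
    ultimately show ?thesis unfolding m_def using cINF_less_iff[OF _ bdd] by metis
  qed
  then obtain y where yS: "\<And>n. y n \<in> S" and yF: "\<And>n. F (y n) < m + 1 / real (Suc n)" by metis
  have par: "(norm (u - v))^2 \<le> 2 * (F u - m) + 2 * (F v - m)" if "u \<in> S" "v \<in> S" for u v
  proof -
    have "(1/2) *\<^sub>R (u + v) \<in> S" using that S(1) by (simp add: subspace_add subspace_scale)
    note m_le[OF this]
    also have "F ((1/2) *\<^sub>R (u + v)) = (norm (u + v))^2 / 4 - (f u + f v)"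
      unfolding F_def f.scaleR norm_scaleR power_mult_distrib by (simp add: f.add power_divide add_divide_distrib)
    finally have "4 * m \<le> (norm (u + v))^2 - 4 * (f u + f v)" by simp
    moreover have "(norm (u - v))^2 + (norm (u + v))^2 = 2 * (norm u)^2 + 2 * (norm v)^2"
      by (simp add: power2_norm_eq_inner inner_add inner_diff)
    ultimately show ?thesis by (simp add: F_def)
  qed
  have "Cauchy y"
  proof (rule metric_CauchyI)
    fix e :: real assume e: "e > 0"
    obtain N where N: "4 / e^2 < real N" using reals_Archimedean2 by blast
    have small: "4 * (F (y n) - m) < e^2" if "n \<ge> N" for n
    proof -
      have "4 / e^2 < real (Suc n)" using N that by linarith
      then have "4 * (1 / real (Suc n)) < e^2" using e by (simp add: field_simps)
      then show ?thesis using yF[of n] by argo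
    qed
    have "dist (y p) (y q) < e" if "p \<ge> N" "q \<ge> N" for p q
    proof -
      have "(norm (y p - y q))^2 < e^2"
        using par[OF yS yS, of p q] small[OF that(1)] small[OF that(2)] by argo
      then show ?thesis using e by (simp add: dist_norm power2_less_imp_less)
    qed
    then show "\<exists>N. \<forall>p\<ge>N. \<forall>q\<ge>N. dist (y p) (y q) < e" by blast
  qed
  then obtain p where p: "y \<longlonglongrightarrow> p" using Cauchy_convergent convergent_def by blast
  have pS: "p \<in> S" using closed_sequentially[OF S(2) _ p] yS by blast
  have "(\<lambda>n. F (y n)) \<longlonglongrightarrow> F p"
    unfolding F_def by (intro tendsto_intros p f.tendsto)
  moreover have "(\<lambda>n. m + 1 / real (Suc n)) \<longlonglongrightarrow> m + 0"
    by (intro tendsto_intros LIMSEQ_Suc[OF lim_1_over_n])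
  ultimately have Fp: "F p \<le> m"
    using yF by (intro LIMSEQ_le) (auto intro: less_imp_le)
  have "inner p w = f w" if w: "w \<in> S" for w
  proof -
    have "0 \<le> 0 + 2 * t * (inner p w - f w) + t^2 * (norm w)^2" for t
    proof -
      have "p + t *\<^sub>R w \<in> S" using pS w S(1) by (simp add: subspace_add subspace_scale)
      from m_le[OF this] Fp have "F p \<le> F (p + t *\<^sub>R w)" by simp
      moreover have "(norm (p + t *\<^sub>R w))^2 = (norm p)^2 + 2 * t * inner p w + t^2 * (norm w)^2"
        unfolding power2_norm_eq_inner
        by (simp add: inner_add inner_commute power2_eq_square algebra_simps)
      ultimately show ?thesis by (simp add: F_def f.add f.scaleR algebra_simps)
    qed
    from quadratic_nonneg_discriminant[OF this] show ?thesis by simp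
  qed
  with pS show ?thesis by blast
qed

lemma orthogonal_projection_exists:
  fixes S :: "'a::{real_inner, complete_space} set"
  assumes "subspace S" "closed S"
  shows "\<exists>p\<in>S. \<forall>w\<in>S. inner p w = inner x w"
  using assms bounded_linear_inner_right by (rule Riesz_on_closed_subspace)

lemma orthogonal_projection_operator:
  fixes S :: "'a::chilbert_space set"
  assumes S: "subspace S" "closed S" "\<And>x. x \<in> S \<Longrightarrow> mult_i x \<in> S"
  shows "\<exists>P. selfadjoint P \<and> (\<forall>x. P x \<in> S) \<and> (\<forall>x\<in>S. P x = x)"
proof -
  obtain P where P: "\<And>x. P x \<in> S" "\<And>x w. w \<in> S \<Longrightarrow> inner (P x) w = inner x w"
    using orthogonal_projection_exists[OF S(1,2)] by metis
  have unique: "P x = p" if "p \<in> S" "\<And>w. w \<in> S \<Longrightarrow> inner p w = inner x w" for x p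
  proof -
    have "P x - p \<in> S" by (intro subspace_diff S P that(1))
    then have "inner (P x - p) (P x - p) = 0" using P(2) that(2) by (simp add: inner_diff_left)
    then show ?thesis by simp
  qed
  have "bounded_linear P"
  proof (rule bounded_linear_intro[where K = 1])
    show "P (x + y) = P x + P y" for x y
      by (rule unique) (simp_all add: subspace_add S P inner_add_left)
    show "P (r *\<^sub>R x) = r *\<^sub>R P x" for r x
      by (rule unique) (simp_all add: subspace_scale S P)
    show "norm (P x) \<le> norm x * 1" for x
    proof (cases "P x = 0")
      case False
      have "(norm (P x))^2 = inner x (P x)" using P(2)[OF P(1), of x x] by (simp add: power2_norm_eq_inner)
      also have "\<dots> \<le> norm x * norm (P x)" by (rule norm_cauchy_schwarz)
      finally show ?thesis using False by (simp add: power2_eq_square)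
    qed simp
  qed
  moreover have "P (mult_i x) = mult_i (P x)" for x
    by (rule unique) (simp_all add: S P inner_mult_i_left)
  moreover have "inner (P x) y = inner x (P y)" for x y
    using P(2)[OF P(1), of x y] P(2)[OF P(1), of y x] by (simp add: inner_commute)
  ultimately have "selfadjoint P" by (simp add: selfadjoint_iff)
  moreover have "P x = x" if "x \<in> S" for x using that by (intro unique) auto
  ultimately show ?thesis using P(1) by blast
qed

lemma orthogonal_dense_imp_0:
  assumes "closure D = UNIV" "\<And>y. y \<in> D \<Longrightarrow> inner x y = 0"
  shows "x = (0::'a::real_inner)"
proof -
  have "closed {y. inner x y = 0}" by (intro closed_Collect_eq continuous_intros)
  then have "closure D \<subseteq> {y. inner x y = 0}" using assms(2) by (intro closure_minimal) auto
  then have "inner x x = 0" using assms(1) by blast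
  then show ?thesis by simp
qed

lemma additive_bounded_imp_homogeneous:
  fixes h :: "real \<Rightarrow> real"
  assumes add: "\<And>r s. h (r + s) = h r + h s" and bd: "\<And>r. \<bar>r\<bar> \<le> 1 \<Longrightarrow> \<bar>h r\<bar> \<le> K"
  shows "h r = r * h 1"
proof -
  define g where "g r = h r - r * h 1" for r
  have g_add: "g (r + s) = g r + g s" for r s by (simp add: g_def add algebra_simps)
  have g1: "g 1 = 0" by (simp add: g_def)
  have g0: "g 0 = 0" using g_add[of 0 0] by simp
  have g_nat: "g (real n * r) = real n * g r" for n r
    by (induction n) (simp_all add: g0 g_add algebra_simps)
  have g_diff: "g (r - s) = g r - g s" for r s using g_add[of "r - s" s] by simp
  have g_int: "g (real_of_int k) = 0" for k
  proof (cases k)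
    case (nonneg n) then show ?thesis using g_nat[of n 1] g1 by simp
  next
    case (neg n)
    have "g (0 - real (Suc n)) = 0" using g_diff[of 0 "real (Suc n)"] g_nat[of "Suc n" 1] g1 g0 by simp
    then show ?thesis using neg by simp
  qed
  \<comment> \<open>\<open>g\<close> has period 1, hence is bounded; an additive bounded function is zero, as \<open>g (n r) = n g r\<close>.\<close>
  have g_bd: "\<bar>g r\<bar> \<le> K + \<bar>h 1\<bar>" for r
  proof -
    have "\<bar>frac r\<bar> \<le> 1" using frac_lt_1[of r] frac_ge_0[of r] by linarith
    moreover have "g r = g (frac r)" by (simp add: frac_def g_diff g_int)
    moreover have "\<bar>frac r * h 1\<bar> \<le> \<bar>h 1\<bar>"
      using calculation(1) by (simp add: abs_mult mult_left_le_one_le)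
    ultimately show ?thesis using bd[of "frac r"] by (simp add: g_def abs_le_iff)
  qed
  have "g r = 0"
  proof (rule ccontr)
    assume "g r \<noteq> 0"
    then obtain n where "K + \<bar>h 1\<bar> < real n * \<bar>g r\<bar>"
      using ex_less_of_nat_mult[of "\<bar>g r\<bar>"] by auto
    then show False using g_bd[of "real n * r"] by (simp add: g_nat abs_mult)
  qed
  then show ?thesis by (simp add: g_def)
qed

text \<open>By the theorem of Jordan and von Neumann the parallelogram law makes the polarisation of \<open>q\<close>
  additive; the bound makes it real-bilinear, and the Riesz representation turns it into a symmetric
  operator. Invariance of \<open>q\<close> under \<open>\<i>\<close> makes that operator complex-linear.\<close>

lemma bounded_quadratic_form_operator:
  fixes q :: "'a::chilbert_space \<Rightarrow> real"
  assumes par: "\<And>x y. q (x + y) + q (x - y) = 2 * q x + 2 * q y"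
    and nonneg: "\<And>x. 0 \<le> q x" and bound: "\<And>x. q x \<le> c * (norm x)^2"
    and q_i: "\<And>x. q (mult_i x) = q x"
  shows "\<exists>A. selfadjoint A \<and> (\<forall>x. inner (A x) x = q x)"
proof -
  define b where "b x y = (q (x + y) - q (x - y)) / 4" for x y
  have q0: "q 0 = 0" using par[of 0 0] by simp
  have qm: "q (- y) = q y" for y using par[of 0 y] q0 by simp
  have b_sym: "b x y = b y x" for x y
    using qm[of "x - y"] by (simp add: b_def add.commute)
  have b0: "b 0 y = 0" for y by (simp add: b_def qm)
  have step: "b (x + z) y + b (x - z) y = 2 * b x y" for x y z
  proof -
    have e: "x + z + y = x + y + z" "x + z - y = x - y + z" "x - z + y = x + y - z" "x - z - y = x - y - z"
      by simp_all
    have "(a - a') / 4 + (d - d') / 4 = 2 * ((f - f') / 4)"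
      if "a + d = 2 * f + 2 * g" "a' + d' = 2 * f' + 2 * g" for a d f g a' d' f' :: real
      using that by (simp add: field_simps)
    from this[OF par[of "x + y" z] par[of "x - y" z]] show ?thesis unfolding b_def e .
  qed
  have double: "b (2 *\<^sub>R x) y = 2 * b x y" for x y
    using step[of x x y] b0 by (simp add: scaleR_2)
  have b_add: "b (x + z) y = b x y + b z y" for x y z
  proof -
    have "(1/2) *\<^sub>R (x + z) + (1/2) *\<^sub>R (x - z) = x" "(1/2) *\<^sub>R (x + z) - (1/2) *\<^sub>R (x - z) = z"
      by (simp_all add: algebra_simps flip: scaleR_add_left)
    then show ?thesis
      using step[of "(1/2) *\<^sub>R (x + z)" "(1/2) *\<^sub>R (x - z)" y] double[of "(1/2) *\<^sub>R (x + z)" y] by simp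
  qed
  have c0: "0 \<le> c * (norm x)^2" for x :: 'a using nonneg[of x] bound[of x] by linarith
  have b_bound0: "\<bar>b x y\<bar> \<le> c * ((norm x)^2 + (norm y)^2) / 2" for x y
  proof -
    have "\<bar>b x y\<bar> \<le> (q (x + y) + q (x - y)) / 4"
      using nonneg[of "x + y"] nonneg[of "x - y"] by (simp add: b_def abs_le_iff)
    then show ?thesis using par[of x y] bound[of x] bound[of y] by (simp add: algebra_simps)
  qed
  have b_scale: "b (r *\<^sub>R x) y = r * b x y" for r x y
  proof -
    have "\<bar>b (r *\<^sub>R x) y\<bar> \<le> c * ((norm x)^2 + (norm y)^2) / 2" if "\<bar>r\<bar> \<le> 1" for r
    proof -
      have "c * (norm (r *\<^sub>R x))^2 = r^2 * (c * (norm x)^2)" by (simp add: power_mult_distrib)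
      also have "\<dots> \<le> 1 * (c * (norm x)^2)"
        using that c0 by (intro mult_right_mono) (simp_all add: abs_square_le_1)
      finally show ?thesis using b_bound0[of "r *\<^sub>R x" y] by (simp add: algebra_simps)
    qed
    from additive_bounded_imp_homogeneous[of "\<lambda>r. b (r *\<^sub>R x) y", OF _ this, of r]
    show ?thesis by (simp add: b_add scaleR_add_left)
  qed
  have b_bound: "\<bar>b x y\<bar> \<le> \<bar>c\<bar> * norm x * norm y" for x y
  proof (cases "x = 0 \<or> y = 0")
    case True
    then show ?thesis using b0[of y] b0[of x] b_sym[of x y] by auto
  next
    case False
    have "b ((1 / norm x) *\<^sub>R x) ((1 / norm y) *\<^sub>R y) = b x y / (norm x * norm y)"
      using b_sym[of x "(1 / norm y) *\<^sub>R y"] b_sym[of x y] by (simp add: b_scale field_simps)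
    with False b_bound0[of "(1 / norm x) *\<^sub>R x" "(1 / norm y) *\<^sub>R y"]
    have "\<bar>b x y\<bar> / (norm x * norm y) \<le> c" by (simp add: abs_mult)
    also have "c \<le> \<bar>c\<bar>" by simp
    finally show ?thesis using False by (simp add: field_simps)
  qed
  have "\<exists>p. \<forall>w. inner p w = b x w" for x
  proof -
    have "bounded_linear (b x)"
      using b_bound[of x] b_sym[of x] b_add b_scale
      by (intro bounded_linear_intro[where K = "\<bar>c\<bar> * norm x"]) (auto simp: algebra_simps)
    from Riesz_on_closed_subspace[OF subspace_UNIV closed_UNIV this] show ?thesis by auto
  qed
  then obtain A where A: "\<And>x w. inner (A x) w = b x w" by metis
  have eqI: "u = v" if "\<And>w. inner u w = inner v w" for u v :: 'a
    using that[of "u - v"] by (metis inner_diff_left inner_eq_zero_iff right_minus_eq)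
  have "bounded_linear A"
  proof (rule bounded_linear_intro[where K = "\<bar>c\<bar>"])
    show "A (x + y) = A x + A y" for x y by (rule eqI) (simp add: A b_add inner_add_left)
    show "A (r *\<^sub>R x) = r *\<^sub>R A x" for r x by (rule eqI) (simp add: A b_scale)
    show "norm (A x) \<le> norm x * \<bar>c\<bar>" for x
    proof (cases "A x = 0")
      case False
      have "(norm (A x))^2 = b x (A x)" by (simp add: power2_norm_eq_inner A)
      also have "\<dots> \<le> \<bar>c\<bar> * norm x * norm (A x)" using b_bound[of x "A x"] by linarith
      finally show ?thesis using False by (simp add: power2_eq_square mult.commute)
    qed simp
  qed
  moreover have "A (mult_i x) = mult_i (A x)" for x
  proof (rule eqI)
    fix w
    have "b (mult_i x) w = b (mult_i (mult_i x)) (mult_i w)"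
      using q_i[of "mult_i x + w"] q_i[of "mult_i x - w"] by (simp add: b_def)
    also have "\<dots> = - b x (mult_i w)" using b_scale[of "-1" x] by simp
    finally show "inner (A (mult_i x)) w = inner (mult_i (A x)) w" by (simp add: A inner_mult_i_left)
  qed
  moreover have "inner (A x) y = inner x (A y)" for x y
    by (metis A b_sym inner_commute)
  ultimately have "selfadjoint A" by (simp add: selfadjoint_iff)
  moreover have "inner (A x) x = q x" for x
    using par[of x x] q0 by (simp add: A b_def)
  ultimately show ?thesis by blast
qed

section \<open>The smallest positive extension\<close>

text \<open>Krein's smallest nonnegative extension \<open>A\<close> of a positive operator \<open>S0\<close> has the quadratic form
  \<open>q x = sup {2 (x, S0 y) - (S0 y, y) | y \<in> D}\<close>. Since \<open>(S0 (x - y), x - y)\<close>, computed with any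
  nonnegative extension \<open>S\<close> of \<open>S0\<close>, is \<open>(S x, x) - (2 (x, S0 y) - (S0 y, y))\<close>,
  the form of \<open>S\<close> dominates \<open>q\<close>, and
  for \<open>A\<close> itself the infimum over \<open>y\<close> vanishes. This last property characterises \<open>A\<close>
  and is what later arguments use in place of minimality.\<close>

lemma smallest_positive_extension:
  fixes S0 :: "'a::chilbert_space \<Rightarrow> 'a"
  assumes D: "subspace D" "\<And>y. y \<in> D \<Longrightarrow> mult_i y \<in> D"
    and add: "\<And>y z. y \<in> D \<Longrightarrow> z \<in> D \<Longrightarrow> S0 (y + z) = S0 y + S0 z"
    and scale: "\<And>r y. y \<in> D \<Longrightarrow> S0 (r *\<^sub>R y) = r *\<^sub>R S0 y"
    and S0_i: "\<And>y. y \<in> D \<Longrightarrow> S0 (mult_i y) = mult_i (S0 y)"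
    and sym: "\<And>y z. y \<in> D \<Longrightarrow> z \<in> D \<Longrightarrow> inner (S0 y) z = inner y (S0 z)"
    and bound: "\<And>y. y \<in> D \<Longrightarrow> (norm (S0 y))^2 \<le> c * inner (S0 y) y" and c: "c > 0"
  shows "\<exists>A. selfadjoint A \<and> (\<forall>x. 0 \<le> inner (A x) x \<and> inner (A x) x \<le> c * (norm x)^2) \<and>
    (\<forall>y\<in>D. A y = S0 y) \<and> (\<forall>x. \<forall>e>0. \<exists>y\<in>D. inner (A (x - y)) (x - y) < e)"
proof -
  define a where "a y = inner (S0 y) y" for y
  define F where "F x y = 2 * inner x (S0 y) - a y" for x y
  define q where "q x = (SUP y\<in>D. F x y)" for x
  have D0: "0 \<in> D" and Dadd: "\<And>y z. y \<in> D \<Longrightarrow> z \<in> D \<Longrightarrow> y + z \<in> D"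
    and Dscale: "\<And>r y. y \<in> D \<Longrightarrow> r *\<^sub>R y \<in> D"
    using D(1) by (auto simp: subspace_def)
  have Ddiff: "y - z \<in> D" if "y \<in> D" "z \<in> D" for y z
    using Dadd[OF that(1) Dscale[OF that(2), of "-1"]] by simp
  have S0_0: "S0 0 = 0" using scale[OF D0, of 0] by simp
  have S0_minus: "S0 (- y) = - S0 y" if "y \<in> D" for y using scale[OF that, of "-1"] by simp
  have S0_diff: "S0 (y - z) = S0 y - S0 z" if "y \<in> D" "z \<in> D" for y z
    using add[OF that(1) Dscale[OF that(2), of "-1"]] S0_minus[OF that(2)] by simp
  have a_scale: "a (r *\<^sub>R y) = r^2 * a y" if "y \<in> D" for r y
    using that by (simp add: a_def scale power2_eq_square)
  have F_le: "F x y \<le> c * (norm x)^2" if "y \<in> D" for x y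
  proof -
    have "inner x (S0 y) \<le> norm x * norm (S0 y)" by (rule norm_cauchy_schwarz)
    then have "2 * c * inner x (S0 y) \<le> 2 * c * (norm x * norm (S0 y))" using c by simp
    moreover have "0 \<le> (c * norm x - norm (S0 y))^2" by simp
    then have "2 * c * (norm x * norm (S0 y)) \<le> c * (c * (norm x)^2) + (norm (S0 y))^2"
      by (simp add: power2_diff power2_eq_square algebra_simps)
    ultimately have "c * (2 * inner x (S0 y)) \<le> c * (c * (norm x)^2) + c * a y"
      using bound[OF that] unfolding a_def by argo
    then have "c * F x y \<le> c * (c * (norm x)^2)" by (simp add: F_def algebra_simps)
    then show ?thesis using c by simp
  qed
  have bdd: "bdd_above (F x ` D)" for x using F_le by (rule bdd_aboveI2)
  have F_q: "F x y \<le> q x" if "y \<in> D" for x y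
    unfolding q_def using bdd that by (rule cSUP_upper2[OF _ _ order_refl])
  have q_le: "q x \<le> u" if "\<And>y. y \<in> D \<Longrightarrow> F x y \<le> u" for x u
    unfolding q_def using D0 that by (intro cSUP_least) auto
  have q_approx: "\<exists>y\<in>D. q x - e < F x y" if "e > 0" for x e
  proof (rule ccontr)
    assume "\<not> ?thesis"
    then have "q x \<le> q x - e" by (intro q_le) (auto simp: not_less)
    with that show False by simp
  qed
  have F_par: "F (x + x') (y + y') + F (x - x') (y - y') = 2 * F x y + 2 * F x' y'"
    if "y \<in> D" "y' \<in> D" for x x' y y'
    using that by (simp add: F_def a_def add S0_diff inner_add inner_diff algebra_simps)
  have q_par_ge: "2 * q x + 2 * q x' \<le> q (x + x') + q (x - x')" for x x'
  proof (rule field_le_epsilon)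
    fix e :: real assume e: "e > 0"
    obtain y where y: "y \<in> D" "q x - e / 4 < F x y" using q_approx[of "e/4" x] e by auto
    obtain y' where y': "y' \<in> D" "q x' - e / 4 < F x' y'" using q_approx[of "e/4" x'] e by auto
    show "2 * q x + 2 * q x' \<le> q (x + x') + q (x - x') + e"
      using F_par[OF y(1) y'(1), of x x'] F_q[OF Dadd[OF y(1) y'(1)], of "x + x'"]
        F_q[OF Ddiff[OF y(1) y'(1)], of "x - x'"] y(2) y'(2) by argo
  qed
  have q_double: "q (2 *\<^sub>R x) \<le> 4 * q x" for x
  proof (rule q_le)
    fix y assume y: "y \<in> D"
    have "F (2 *\<^sub>R x) y = 4 * F x ((1/2) *\<^sub>R y)"
      using y by (simp add: F_def a_scale scale power2_eq_square)
    then show "F (2 *\<^sub>R x) y \<le> 4 * q x" using F_q[OF Dscale[OF y, of "1/2"], of x] by simp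
  qed
  have par: "q (x + x') + q (x - x') = 2 * q x + 2 * q x'" for x x'
  proof (rule antisym)
    have "2 * q (x + x') + 2 * q (x - x') \<le> q (2 *\<^sub>R x) + q (2 *\<^sub>R x')"
      using q_par_ge[of "x + x'" "x - x'"] by (simp add: scaleR_2)
    then show "q (x + x') + q (x - x') \<le> 2 * q x + 2 * q x'"
      using q_double[of x] q_double[of x'] by argo
  qed (rule q_par_ge)
  have q_nonneg: "0 \<le> q x" for x
    using F_q[OF D0, of x] by (simp add: F_def a_def S0_0)
  have q_bound: "q x \<le> c * (norm x)^2" for x by (rule q_le) (rule F_le)
  have q_i_le: "q (mult_i x) \<le> q x" for x
  proof (rule q_le)
    fix y assume y: "y \<in> D"
    have iy: "- mult_i y \<in> D" using Dscale[OF D(2)[OF y], of "-1"] by simp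
    have "F (mult_i x) y = F x (- mult_i y)"
      using y by (simp add: F_def a_def S0_minus D(2) S0_i inner_mult_i_left)
    then show "F (mult_i x) y \<le> q x" using F_q[OF iy, of x] by simp
  qed
  have q_i: "q (mult_i x) = q x" for x
    using q_i_le[of x] q_i_le[of "mult_i x"] q_i_le[of "- x"] q_i_le[of "- mult_i x"] by simp
  obtain A where A: "selfadjoint A" "\<And>x. inner (A x) x = q x"
    using bounded_quadratic_form_operator[of q c, OF par q_nonneg q_bound q_i] by blast
  have q_shift: "q (z + x) = q z + 2 * inner z (S0 x) + a x" if x: "x \<in> D" for x z
  proof -
    have F_shift: "F (z + x) (w + x) = F z w + 2 * inner z (S0 x) + a x" if w: "w \<in> D" for w
      using x w sym[OF w x]
      by (simp add: F_def a_def add inner_add algebra_simps inner_commute)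
    show ?thesis
    proof (rule antisym)
      show "q (z + x) \<le> q z + 2 * inner z (S0 x) + a x"
      proof (rule q_le)
        fix y assume y: "y \<in> D"
        show "F (z + x) y \<le> q z + 2 * inner z (S0 x) + a x"
          using F_shift[OF Ddiff[OF y x]] F_q[OF Ddiff[OF y x], of z] by simp
      qed
      have "q z \<le> q (z + x) - 2 * inner z (S0 x) - a x"
      proof (rule q_le)
        fix w assume w: "w \<in> D"
        show "F z w \<le> q (z + x) - 2 * inner z (S0 x) - a x"
          using F_shift[OF w] F_q[OF Dadd[OF w x], of "z + x"] by simp
      qed
      then show "q z + 2 * inner z (S0 x) + a x \<le> q (z + x)" by simp
    qed
  qed
  have A_eq: "A x = S0 x" if x: "x \<in> D" for x
  proof -
    have q0: "q 0 = 0" using A(2)[of 0] by simp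
    have "inner z (A x) = inner z (S0 x)" for z
    proof -
      have "q (z + x) = q z + 2 * inner z (A x) + q x"
        unfolding A(2)[symmetric] using selfadjointD(3)[OF A(1), of x z]
        by (simp add: selfadjointD[OF A(1)] inner_add inner_commute algebra_simps)
      moreover have "q x = a x" using q_shift[OF x, of 0] q0 by simp
      ultimately show ?thesis using q_shift[OF x, of z] by simp
    qed
    from this[of "A x - S0 x"] show ?thesis
      by (metis inner_diff_right inner_eq_zero_iff right_minus_eq)
  qed
  have "\<exists>y\<in>D. inner (A (x - y)) (x - y) < e" if e: "e > 0" for x e
  proof -
    obtain y where y: "y \<in> D" "q x - e < F x y" using q_approx[OF e] by blast
    have "inner (A (x - y)) (x - y) = inner (A x) x - 2 * inner x (A y) + inner (A y) y"
      using selfadjointD(3)[OF A(1), of x y]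
      by (simp add: selfadjointD[OF A(1)] inner_diff inner_commute algebra_simps)
    also have "\<dots> = q x - F x y" using y(1) by (simp add: A(2) A_eq F_def a_def)
    finally show ?thesis using y by (intro bexI[of _ y]) simp_all
  qed
  then show ?thesis by (intro exI[of _ A]) (simp add: A A_eq q_nonneg q_bound)
qed

section \<open>Square roots of positive operators\<close>

text \<open>For \<open>\<parallel>B\<parallel> \<le> 1\<close> the equation \<open>Y = (B + Y\<^sup>2) / 2\<close> says that \<open>1 - Y\<close> is a square root of \<open>1 - B\<close>.
  Its iterates \<open>Y\<^sub>n\<close> from \<open>0\<close> have increments dominated by those of the scalar iteration
  \<open>s\<^sub>n\<^sub>+\<^sub>1 = (1 + s\<^sub>n\<^sup>2) / 2\<close>, which is increasing and bounded by \<open>1\<close>; hence they converge.\<close>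

fun sqrt_majorant :: "nat \<Rightarrow> real" where
  "sqrt_majorant 0 = 0"
| "sqrt_majorant (Suc n) = (1 + (sqrt_majorant n)^2) / 2"

fun sqrt_iter :: "('a::real_vector \<Rightarrow> 'a) \<Rightarrow> nat \<Rightarrow> 'a \<Rightarrow> 'a" where
  "sqrt_iter B 0 x = 0"
| "sqrt_iter B (Suc n) x = (1/2) *\<^sub>R (B x + sqrt_iter B n (sqrt_iter B n x))"

declare sqrt_majorant.simps(2) [simp del] sqrt_iter.simps(2) [simp del]

lemma sqrt_majorant_bounds: "0 \<le> sqrt_majorant n \<and> sqrt_majorant n \<le> 1"
proof (induction n)
  case (Suc n)
  then have "(sqrt_majorant n)^2 \<le> 1" by (simp add: abs_square_le_1)
  then show ?case by (simp add: sqrt_majorant.simps)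
qed simp

lemma sqrt_majorant_mono: "incseq sqrt_majorant"
proof (rule incseq_SucI)
  fix n
  have "0 \<le> (1 - sqrt_majorant n)^2" by simp
  then show "sqrt_majorant n \<le> sqrt_majorant (Suc n)" by (simp add: sqrt_majorant.simps power2_eq_square algebra_simps)
qed

lemma sqrt_iter_selfadjoint:
  assumes "selfadjoint (B :: 'a::complex_inner \<Rightarrow> 'a)"
  shows "selfadjoint (sqrt_iter B n)"
proof (induction n)
  case 0
  show ?case by (simp add: selfadjoint_iff bounded_linear_zero)
next
  case (Suc n)
  have "selfadjoint (\<lambda>x. sqrt_iter B n (sqrt_iter B n x))"
    using selfadjoint_sandwich[OF Suc selfadjoint_id] by simp
  from selfadjoint_scaleR[OF selfadjoint_add[OF assms this], of "1/2"] show ?case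
    by (simp only: sqrt_iter.simps(2)[abs_def])
qed

lemma sqrt_iter_commute:
  assumes "bounded_linear U" "\<And>x. U (B x) = B (U x)"
  shows "U (sqrt_iter B n x) = sqrt_iter B n (U x)"
proof (induction n arbitrary: x)
  case 0
  show ?case using linear_0[OF bounded_linear.linear[OF assms(1)]] by simp
next
  case (Suc n)
  interpret bounded_linear U by (rule assms(1))
  show ?case using assms(2) Suc by (simp add: sqrt_iter.simps add scaleR)
qed

lemma sqrt_iter_norm:
  fixes B :: "'a::complex_inner \<Rightarrow> 'a"
  assumes B: "\<And>x. norm (B x) \<le> norm x"
  shows "norm (sqrt_iter B n x) \<le> sqrt_majorant n * norm x"
proof (induction n arbitrary: x)
  case (Suc n)
  note s = sqrt_majorant_bounds[of n]
  have "norm (sqrt_iter B n (sqrt_iter B n x)) \<le> sqrt_majorant n * (sqrt_majorant n * norm x)"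
    using Suc[of "sqrt_iter B n x"] mult_left_mono[OF Suc[of x], of "sqrt_majorant n"] s by linarith
  then have "norm (B x + sqrt_iter B n (sqrt_iter B n x)) \<le> norm x + (sqrt_majorant n)^2 * norm x"
    using B[of x] norm_triangle_ineq[of "B x" "sqrt_iter B n (sqrt_iter B n x)"]
    by (simp add: power2_eq_square)
  then show ?case unfolding sqrt_iter.simps sqrt_majorant.simps norm_scaleR by (simp add: algebra_simps)
qed simp

text \<open>Twice the next increment is \<open>Y\<^sub>n\<^sub>+\<^sub>1\<^sup>2 - Y\<^sub>n\<^sup>2 = Y\<^sub>n\<^sub>+\<^sub>1 (Y\<^sub>n\<^sub>+\<^sub>1 - Y\<^sub>n) + (Y\<^sub>n\<^sub>+\<^sub>1 - Y\<^sub>n) Y\<^sub>n\<close>. Bounding each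
  factor by its scalar counterpart gives the same expression for the scalar iteration.\<close>

lemma sqrt_iter_increment:
  fixes B :: "'a::complex_inner \<Rightarrow> 'a"
  assumes sa: "selfadjoint B" and B: "\<And>x. norm (B x) \<le> norm x"
  shows "norm (sqrt_iter B (Suc n) x - sqrt_iter B n x)
    \<le> (sqrt_majorant (Suc n) - sqrt_majorant n) * norm x"
proof (induction n arbitrary: x)
  case 0
  show ?case using B[of x] by (simp add: sqrt_iter.simps sqrt_majorant.simps)
next
  case (Suc n)
  let ?Y = "sqrt_iter B"
  define a b where "a = sqrt_majorant n" and "b = sqrt_majorant (Suc n)"
  define d where "d x = ?Y (Suc n) x - ?Y n x" for x
  have IH: "norm (d x) \<le> (b - a) * norm x" for x using Suc by (simp only: d_def a_def b_def)
  have s: "0 \<le> a" "0 \<le> b" "0 \<le> b - a"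
    using sqrt_majorant_bounds[of n] sqrt_majorant_bounds[of "Suc n"] incseq_SucD[OF sqrt_majorant_mono, of n]
    unfolding a_def b_def by linarith+
  have d_sum: "?Y (Suc n) (?Y (Suc n) x) - ?Y n (?Y n x) = ?Y (Suc n) (d x) + d (?Y n x)"
    unfolding d_def selfadjointD(5)[OF sqrt_iter_selfadjoint[OF sa]] by simp
  have "2 *\<^sub>R (?Y (Suc (Suc n)) x - ?Y (Suc n) x) = ?Y (Suc n) (d x) + d (?Y n x)"
    unfolding d_sum[symmetric] scaleR_diff_right sqrt_iter.simps(2)[of B "Suc n"] sqrt_iter.simps(2)[of B n x]
    by (simp del: sqrt_iter.simps)
  then have "2 * norm (?Y (Suc (Suc n)) x - ?Y (Suc n) x) = norm (?Y (Suc n) (d x) + d (?Y n x))"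
    by (metis abs_numeral norm_scaleR)
  also have "\<dots> \<le> b * ((b - a) * norm x) + (b - a) * (a * norm x)"
  proof (rule norm_triangle_le[OF add_mono])
    show "norm (?Y (Suc n) (d x)) \<le> b * ((b - a) * norm x)"
      using sqrt_iter_norm[OF B, of "Suc n" "d x", folded b_def] mult_left_mono[OF IH[of x] s(2)]
      by (rule order_trans)
    show "norm (d (?Y n x)) \<le> (b - a) * (a * norm x)"
      using IH[of "?Y n x"] mult_left_mono[OF sqrt_iter_norm[OF B, of n x, folded a_def] s(3)]
      by (rule order_trans)
  qed
  also have "\<dots> = (b^2 - a^2) * norm x" by (simp add: power2_eq_square algebra_simps)
  also have "b^2 - a^2 = 2 * (sqrt_majorant (Suc (Suc n)) - b)"
    using sqrt_majorant.simps(2)[of "Suc n", folded b_def] sqrt_majorant.simps(2)[of n, folded a_def b_def]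
    by argo
  finally show ?case by (simp add: b_def algebra_simps)
qed

lemma sqrt_iter_difference:
  fixes B :: "'a::complex_inner \<Rightarrow> 'a"
  assumes sa: "selfadjoint B" and B: "\<And>x. norm (B x) \<le> norm x"
  shows "norm (sqrt_iter B (n + k) x - sqrt_iter B n x)
    \<le> (sqrt_majorant (n + k) - sqrt_majorant n) * norm x"
proof (induction k)
  case (Suc k)
  have "sqrt_iter B (n + Suc k) x - sqrt_iter B n x
    = (sqrt_iter B (Suc (n + k)) x - sqrt_iter B (n + k) x) + (sqrt_iter B (n + k) x - sqrt_iter B n x)"
    by simp
  then have "norm (sqrt_iter B (n + Suc k) x - sqrt_iter B n x) \<le>
    (sqrt_majorant (Suc (n + k)) - sqrt_majorant (n + k)) * norm x
    + (sqrt_majorant (n + k) - sqrt_majorant n) * norm x"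
    using norm_triangle_le[OF add_mono[OF sqrt_iter_increment[OF sa B, of "n + k" x] Suc]] by (simp only:)
  then show ?case by (simp add: algebra_simps)
qed simp

text \<open>\<open>Y\<close> is the pointwise limit of the iterates; whatever commutes with \<open>B\<close> commutes with all of them,
  hence with \<open>Y\<close>.\<close>

lemma sqrt_of_contraction_defect:
  fixes B :: "'a::chilbert_space \<Rightarrow> 'a"
  assumes sa: "selfadjoint B" and B: "\<And>x. norm (B x) \<le> norm x"
  shows "\<exists>Y. selfadjoint Y \<and> (\<forall>x. 2 *\<^sub>R Y x = B x + Y (Y x)) \<and>
    (\<forall>U. bounded_linear U \<longrightarrow> (\<forall>x. U (B x) = B (U x)) \<longrightarrow> (\<forall>x. U (Y x) = Y (U x)))"
proof -
  let ?Y = "sqrt_iter B" and ?s = sqrt_majorant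
  have Y_sa: "selfadjoint (?Y n)" for n by (rule sqrt_iter_selfadjoint[OF sa])
  note Y_lin = selfadjointD[OF Y_sa]
  have Y_norm: "norm (?Y n x) \<le> norm x" for n x
    using sqrt_iter_norm[OF B, of n x] mult_right_mono[of "?s n" 1 "norm x"] sqrt_majorant_bounds[of n]
    by simp
  obtain l where l: "?s \<longlonglongrightarrow> l" "\<And>n. ?s n \<le> l"
    using incseq_convergent[OF sqrt_majorant_mono] sqrt_majorant_bounds by blast
  have Cauchy_Y: "Cauchy (\<lambda>n. ?Y n x)" for x
  proof (rule metric_CauchyI)
    fix e :: real assume e: "e > 0"
    have "(\<lambda>n. (l - ?s n) * norm x) \<longlonglongrightarrow> (l - l) * norm x" by (intro tendsto_intros l)
    then have "\<forall>\<^sub>F n in sequentially. (l - ?s n) * norm x < e / 2"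
      using e by (intro order_tendstoD(2)) auto
    then obtain N where N: "(l - ?s N) * norm x < e / 2" by (auto simp: eventually_sequentially)
    have near: "norm (?Y n x - ?Y N x) < e / 2" if n: "n \<ge> N" for n
    proof -
      obtain k where k: "n = N + k" using le_Suc_ex[OF n] by blast
      have "(?s n - ?s N) * norm x \<le> (l - ?s N) * norm x"
        using l(2)[of n] by (intro mult_right_mono) auto
      then show ?thesis using sqrt_iter_difference[OF sa B, of N k x] N unfolding k by linarith
    qed
    have "dist (?Y m x) (?Y n x) < e" if "m \<ge> N" "n \<ge> N" for m n
    proof -
      have "dist (?Y m x) (?Y n x) \<le> norm (?Y m x - ?Y N x) + norm (?Y n x - ?Y N x)"
        using dist_triangle2[of "?Y m x" "?Y n x" "?Y N x"] by (simp add: dist_norm)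
      then show ?thesis using near[OF that(1)] near[OF that(2)] by linarith
    qed
    then show "\<exists>N. \<forall>m\<ge>N. \<forall>n\<ge>N. dist (?Y m x) (?Y n x) < e" by blast
  qed
  define Y where "Y x = lim (\<lambda>n. ?Y n x)" for x
  have lim: "(\<lambda>n. ?Y n x) \<longlonglongrightarrow> Y x" for x
    unfolding Y_def using Cauchy_convergent[OF Cauchy_Y] by (simp add: convergent_LIMSEQ_iff)
  have Y_comm: "U (Y x) = Y (U x)" if U: "bounded_linear U" "\<And>x. U (B x) = B (U x)" for U x
  proof (rule LIMSEQ_unique)
    show "(\<lambda>n. U (?Y n x)) \<longlonglongrightarrow> U (Y x)" by (rule bounded_linear.tendsto[OF U(1) lim])
    show "(\<lambda>n. U (?Y n x)) \<longlonglongrightarrow> Y (U x)"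
      using lim[of "U x"] sqrt_iter_commute[of U B, OF U] by simp
  qed
  have "selfadjoint Y" unfolding selfadjoint_iff
  proof (intro conjI allI)
    show "bounded_linear Y"
    proof (rule bounded_linear_intro[where K = 1])
      fix x y :: 'a and r :: real
      have "(\<lambda>n. ?Y n (x + y)) \<longlonglongrightarrow> Y x + Y y"
        using tendsto_add[OF lim[of x] lim[of y]] by (simp add: Y_lin)
      then show "Y (x + y) = Y x + Y y" by (rule LIMSEQ_unique[OF lim])
      have "(\<lambda>n. ?Y n (r *\<^sub>R x)) \<longlonglongrightarrow> r *\<^sub>R Y x"
        using tendsto_scaleR[OF tendsto_const lim[of x]] by (simp add: Y_lin)
      then show "Y (r *\<^sub>R x) = r *\<^sub>R Y x" by (rule LIMSEQ_unique[OF lim])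
      have "norm (Y x) \<le> norm x"
        using tendsto_norm[OF lim[of x]] by (rule LIMSEQ_le_const2) (use Y_norm in blast)
      then show "norm (Y x) \<le> norm x * 1" by simp
    qed
    show "Y (mult_i x) = mult_i (Y x)" for x
      using Y_comm[OF bounded_linear_mult_i] selfadjointD(2)[OF sa] by metis
    show "inner (Y x) y = inner x (Y y)" for x y
    proof (rule LIMSEQ_unique)
      show "(\<lambda>n. inner (?Y n x) y) \<longlonglongrightarrow> inner (Y x) y" by (intro tendsto_intros lim)
      show "(\<lambda>n. inner (?Y n x) y) \<longlonglongrightarrow> inner x (Y y)"
        unfolding Y_lin(3) by (intro tendsto_intros lim)
    qed
  qed
  moreover have "2 *\<^sub>R Y x = B x + Y (Y x)" for x
  proof -
    have "(\<lambda>n. ?Y n (?Y n x) - ?Y n (Y x)) \<longlonglongrightarrow> 0"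
    proof (rule Lim_null_comparison)
      show "\<forall>\<^sub>F n in sequentially. norm (?Y n (?Y n x) - ?Y n (Y x)) \<le> norm (?Y n x - Y x)"
        using Y_norm[of _ "?Y _ x - Y x"] by (simp add: Y_lin)
      show "(\<lambda>n. norm (?Y n x - Y x)) \<longlonglongrightarrow> 0"
        using lim[of x] by (simp add: LIM_zero tendsto_norm_zero)
    qed
    from tendsto_add[OF this lim[of "Y x"]]
    have "(\<lambda>n. ?Y n (?Y n x)) \<longlonglongrightarrow> Y (Y x)" by simp
    then have "(\<lambda>n. (1/2) *\<^sub>R (B x + ?Y n (?Y n x))) \<longlonglongrightarrow> (1/2) *\<^sub>R (B x + Y (Y x))"
      by (intro tendsto_intros)
    moreover have "(\<lambda>n. (1/2) *\<^sub>R (B x + ?Y n (?Y n x))) \<longlonglongrightarrow> Y x"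
      using LIMSEQ_Suc[OF lim[of x]] by (simp add: sqrt_iter.simps)
    ultimately have "Y x = (1/2) *\<^sub>R (B x + Y (Y x))" by (rule LIMSEQ_unique[rotated])
    from arg_cong[OF this, of "\<lambda>v. 2 *\<^sub>R v"] show ?thesis by simp
  qed
  ultimately show ?thesis using Y_comm by blast
qed

lemma positive_sqrt:
  fixes C :: "'a::chilbert_space \<Rightarrow> 'a"
  assumes C: "selfadjoint C" "\<And>x. 0 \<le> inner (C x) x" "\<And>x. inner (C x) x \<le> c * (norm x)^2"
    and c: "c > 0"
  shows "\<exists>R. selfadjoint R \<and> (\<forall>x. R (R x) = C x) \<and>
    (\<forall>U. bounded_linear U \<longrightarrow> (\<forall>x. U (C x) = C (U x)) \<longrightarrow> (\<forall>x. U (R x) = R (U x)))"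
proof -
  define B where "B x = x - (1/c) *\<^sub>R C x" for x
  have B_sa: "selfadjoint B"
    unfolding B_def by (intro selfadjoint_diff selfadjoint_id selfadjoint_scaleR C)
  have "norm (B x) \<le> norm x" for x
  proof (rule selfadjoint_contraction[OF B_sa])
    fix x
    have "inner (B x) x = (norm x)^2 - inner (C x) x / c"
      by (simp add: B_def inner_diff_left power2_norm_eq_inner)
    moreover have "0 \<le> inner (C x) x / c" "inner (C x) x / c \<le> (norm x)^2"
      using C(2,3)[of x] c by (simp_all add: field_simps)
    ultimately show "\<bar>inner (B x) x\<bar> \<le> (norm x)^2" by simp
  qed
  from sqrt_of_contraction_defect[OF B_sa this] obtain Y where Y: "selfadjoint Y"
    "\<And>x. 2 *\<^sub>R Y x = B x + Y (Y x)"
    "\<And>U x. bounded_linear U \<Longrightarrow> (\<And>x. U (B x) = B (U x)) \<Longrightarrow> U (Y x) = Y (U x)" by metis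
  define R where "R x = sqrt c *\<^sub>R (x - Y x)" for x
  have "selfadjoint R"
    unfolding R_def by (intro selfadjoint_diff selfadjoint_id selfadjoint_scaleR Y)
  moreover have "R (R x) = C x" for x
  proof -
    have "R (R x) = c *\<^sub>R ((x - Y x) - Y (x - Y x))"
      using c by (simp add: R_def selfadjointD[OF Y(1)] flip: scaleR_diff_right)
    also have "(x - Y x) - Y (x - Y x) = x - 2 *\<^sub>R Y x + Y (Y x)"
      by (simp add: selfadjointD[OF Y(1)] scaleR_2)
    also have "\<dots> = (1/c) *\<^sub>R C x" by (simp add: Y(2) B_def)
    finally show ?thesis using c by simp
  qed
  moreover have "U (R x) = R (U x)" if U: "bounded_linear U" "\<And>x. U (C x) = C (U x)" for U x
  proof -
    interpret bounded_linear U by (rule U)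
    have "U (Y x) = Y (U x)" by (intro Y(3) U) (simp add: B_def diff scaleR U(2))
    then show ?thesis by (simp add: R_def diff scaleR)
  qed
  ultimately show ?thesis by blast
qed

lemma subspace_closure:
  fixes S :: "'a::real_normed_vector set"
  assumes "subspace S"
  shows "subspace (closure S)"
  unfolding subspace_def
proof (intro conjI ballI allI)
  show "0 \<in> closure S" using subspace_0[OF assms] closure_subset by blast
  fix x r assume "x \<in> closure S"
  then obtain X where X: "\<And>n. X n \<in> S" "X \<longlonglongrightarrow> x" by (auto simp: closure_sequential)
  then show "r *\<^sub>R x \<in> closure S"
    using subspace_scale[OF assms] tendsto_scaleR[OF tendsto_const X(2)]
    by (auto simp: closure_sequential intro!: exI[of _ "\<lambda>n. r *\<^sub>R X n"])
  fix y assume "y \<in> closure S"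
  then obtain Y where Y: "\<And>n. Y n \<in> S" "Y \<longlonglongrightarrow> y" by (auto simp: closure_sequential)
  then show "x + y \<in> closure S"
    using subspace_add[OF assms] tendsto_add[OF X(2) Y(2)] X(1)
    by (auto simp: closure_sequential intro!: exI[of _ "\<lambda>n. X n + Y n"])
qed

text \<open>The part of \<open>R x\<close> orthogonal to the range of \<open>R\<^sup>2\<close> is annihilated by \<open>R\<^sup>2\<close>, hence by the
  self-adjoint \<open>R\<close>, and is therefore orthogonal to \<open>R x\<close> itself.\<close>

lemma closure_range_of_square:
  fixes R :: "'a::chilbert_space \<Rightarrow> 'a"
  assumes R: "selfadjoint R"
  shows "closure (range (\<lambda>x. R (R x))) = closure (range R)"
proof
  let ?S = "closure (range (\<lambda>x. R (R x)))"
  show "?S \<subseteq> closure (range R)" by (intro closure_mono) auto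
  have "linear (\<lambda>x. R (R x))"
    using selfadjointD(1)[OF selfadjoint_sandwich[OF R selfadjoint_id]] by (rule bounded_linear.linear)
  then have sub: "subspace ?S"
    by (intro subspace_closure linear_subspace_image subspace_UNIV)
  have "R x \<in> ?S" for x
  proof -
    obtain p where p: "p \<in> ?S" "\<And>w. w \<in> ?S \<Longrightarrow> inner p w = inner (R x) w"
      using orthogonal_projection_exists[OF sub closed_closure] by blast
    define d where "d = R x - p"
    have d_orth: "inner d w = 0" if "w \<in> ?S" for w using p(2)[OF that] by (simp add: d_def inner_diff_left)
    have "inner (R d) (R d) = inner d (R (R d))" by (simp add: selfadjointD(3)[OF R, of d])
    also have "\<dots> = 0" by (intro d_orth closure_subset[THEN subsetD]) auto
    finally have "R d = 0" by simp
    then have "inner d (R x) = 0" using selfadjointD(3)[OF R, of d x] by simp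
    then have "inner d d = 0" using d_orth[OF p(1)] by (simp add: d_def inner_diff_right inner_commute)
    then show "R x \<in> ?S" using p(1) by (simp add: d_def)
  qed
  then show "closure (range R) \<subseteq> ?S" by (intro closure_minimal) auto
qed

section \<open>Fundamental symmetries\<close>

locale krein_space =
  fixes J :: "'a::chilbert_space \<Rightarrow> 'a"
  assumes fundamental_symmetry: "fundamental_symmetry J"
begin

abbreviation "Pp \<equiv> P_plus J"
abbreviation "Pm \<equiv> P_minus J"

lemma J_selfadjoint: "selfadjoint J"
  using fundamental_symmetry by (simp add: fundamental_symmetry_def)

lemmas J_simps = selfadjointD(2,4-8)[OF J_selfadjoint]
lemmas J_sym = selfadjointD(3)[OF J_selfadjoint]

lemma J_J [simp]: "J (J x) = x"
  using fundamental_symmetry by (simp add: fundamental_symmetry_def fun_eq_iff)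

lemma inner_J_J [simp]: "inner (J x) (J y) = inner x y"
  by (simp add: J_sym)

lemma norm_J [simp]: "norm (J x) = norm x"
  by (simp add: norm_eq_sqrt_inner)

lemma P_plus_selfadjoint: "selfadjoint Pp"
  using selfadjoint_scaleR[OF selfadjoint_add[OF selfadjoint_id J_selfadjoint], of "1/2"]
  by (simp add: P_plus_def[abs_def])

lemma P_minus_selfadjoint: "selfadjoint Pm"
  using selfadjoint_scaleR[OF selfadjoint_diff[OF selfadjoint_id J_selfadjoint], of "1/2"]
  by (simp add: P_minus_def[abs_def])

lemmas Pp_simps = selfadjointD(2,4-8)[OF P_plus_selfadjoint]
lemmas Pm_simps = selfadjointD(2,4-8)[OF P_minus_selfadjoint]

lemma J_P [simp]: "J (Pp x) = Pp x" "J (Pm x) = - Pm x"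
  by (simp_all add: P_plus_def P_minus_def J_simps add.commute flip: scaleR_minus_right)

lemma P_sum: "Pp x + Pm x = x"
  by (simp add: P_plus_def P_minus_def flip: scaleR_add_right scaleR_2)

lemma J_eq: "J x = Pp x - Pm x"
  by (metis J_P J_simps(2) P_sum uminus_add_conv_diff add.commute)

lemma P_of_plus: "J x = x \<Longrightarrow> Pp x = x" "J x = x \<Longrightarrow> Pm x = 0"
  by (simp_all add: P_plus_def P_minus_def flip: scaleR_2)

lemma P_of_minus: "J x = - x \<Longrightarrow> Pp x = 0" "J x = - x \<Longrightarrow> Pm x = x"
  by (simp_all add: P_plus_def P_minus_def flip: scaleR_2)

lemma range_P: "range Pp = {x. J x = x}" "range Pm = {x. J x = - x}"
  using P_of_plus(1) P_of_minus(2) by (auto intro: rangeI[of Pp] rangeI[of Pm] simp: image_iff) metis+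

lemma plus_minus_orthogonal: "J x = x \<Longrightarrow> J y = - y \<Longrightarrow> inner x y = 0"
  using J_sym[of x y] by simp

end

section \<open>The associated operator and the operator interval of its extensions\<close>

locale dual_definite_pair = krein_space J for J :: "'a::chilbert_space \<Rightarrow> 'a" +
  fixes Lpos Lneg :: "'a set"
  assumes dual_definite: "dual_definite J Lpos Lneg"
begin

abbreviation "dom0 \<equiv> T0_dom J Lpos Lneg"
abbreviation "T0 \<equiv> T0_op J Lpos Lneg"
abbreviation "extensions \<equiv> sa_contractive_extensions J Lpos Lneg"

lemma Lpos_subspace: "closed_csubspace Lpos" and Lneg_subspace: "closed_csubspace Lneg"
  and Lpos_pos: "f \<in> Lpos \<Longrightarrow> f \<noteq> 0 \<Longrightarrow> 0 < inner (J f) f"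
  and Lneg_neg: "g \<in> Lneg \<Longrightarrow> g \<noteq> 0 \<Longrightarrow> inner (J g) g < 0"
  and L_orthogonal: "f \<in> Lpos \<Longrightarrow> g \<in> Lneg \<Longrightarrow> inner (J f) g = 0"
  using dual_definite
  by (auto simp: dual_definite_def positive_subspace_def negative_subspace_def indef_def Re_cinner[symmetric])

lemmas Lpos_closed = closed_csubspaceD[OF Lpos_subspace]
lemmas Lneg_closed = closed_csubspaceD[OF Lneg_subspace]

text \<open>Two candidates for the value differ by a vector of \<open>Lpos\<close> that lies in the negative part of the
  space, which must be zero.\<close>

lemma K_plus_eq:
  assumes f: "f \<in> Lpos"
  shows "K_plus J Lpos (Pp f) = Pm f"
  unfolding K_plus_def
proof (rule the_equality)
  show "Pm f \<in> range Pm \<and> Pp f + Pm f \<in> Lpos" using f by (simp add: P_sum)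
  fix y assume y: "y \<in> range Pm \<and> Pp f + y \<in> Lpos"
  define d where "d = y - Pm f"
  have "(Pp f + y) - f \<in> Lpos" using y f Lpos_closed(3) by blast
  moreover have "(Pp f + y) - f = d" using P_sum[of f] by (simp add: d_def algebra_simps)
  ultimately have "d \<in> Lpos" by simp
  moreover have "J d = - d" using y by (auto simp: range_P d_def J_simps)
  ultimately have "d = 0" using Lpos_pos[of d] inner_ge_zero[of d] by (auto simp del: inner_ge_zero)
  then show "y = Pm f" by (simp add: d_def)
qed

lemma K_minus_eq:
  assumes g: "g \<in> Lneg"
  shows "K_minus J Lneg (Pm g) = Pp g"
  unfolding K_minus_def
proof (rule the_equality)
  show "Pp g \<in> range Pp \<and> Pm g + Pp g \<in> Lneg" using g P_sum[of g] by (simp add: add.commute)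
  fix y assume y: "y \<in> range Pp \<and> Pm g + y \<in> Lneg"
  define d where "d = y - Pp g"
  have "(Pm g + y) - g \<in> Lneg" using y g Lneg_closed(3) by blast
  moreover have "(Pm g + y) - g = d" using P_sum[of g] by (simp add: d_def algebra_simps)
  ultimately have "d \<in> Lneg" by simp
  moreover have "J d = d" using y by (auto simp: range_P d_def J_simps)
  ultimately have "d = 0" using Lneg_neg[of d] inner_ge_zero[of d] by (auto simp del: inner_ge_zero)
  then show "y = Pp g" by (simp add: d_def)
qed

lemma P_combination [simp]:
  "Pp (Pp f + Pm g) = Pp f" "Pm (Pp f + Pm g) = Pm g"
  by (simp_all add: Pp_simps Pm_simps P_of_plus P_of_minus)

lemma T0_eq: "f \<in> Lpos \<Longrightarrow> g \<in> Lneg \<Longrightarrow> T0 (Pp f + Pm g) = Pm f + Pp g"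
  by (simp add: T0_op_def K_plus_eq K_minus_eq)

lemma dom0_eq: "dom0 = {Pp f + Pm g | f g. f \<in> Lpos \<and> g \<in> Lneg}"
  by (auto simp: T0_dom_def M_plus_def M_minus_def alg_sum_def)

lemma dom0I: "f \<in> Lpos \<Longrightarrow> g \<in> Lneg \<Longrightarrow> Pp f + Pm g \<in> dom0"
  by (auto simp: dom0_eq)

lemma dom0E:
  assumes "x \<in> dom0"
  obtains f g where "f \<in> Lpos" "g \<in> Lneg" "x = Pp f + Pm g" "T0 x = Pm f + Pp g"
  using assms T0_eq by (auto simp: dom0_eq)

lemma dom0_add: assumes "x \<in> dom0" "y \<in> dom0"
  shows "x + y \<in> dom0 \<and> T0 (x + y) = T0 x + T0 y"
proof -
  from assms obtain f g f' g' where h: "f \<in> Lpos" "g \<in> Lneg" "x = Pp f + Pm g" "T0 x = Pm f + Pp g"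
    "f' \<in> Lpos" "g' \<in> Lneg" "y = Pp f' + Pm g'" "T0 y = Pm f' + Pp g'" by (metis dom0E)
  have "x + y = Pp (f + f') + Pm (g + g')" by (simp add: h Pp_simps Pm_simps)
  then show ?thesis
    using dom0I[of "f + f'" "g + g'"] T0_eq[of "f + f'" "g + g'"] h
    by (simp add: Lpos_closed Lneg_closed Pp_simps Pm_simps add_ac)
qed

lemma dom0_scale: assumes "x \<in> dom0"
  shows "r *\<^sub>R x \<in> dom0 \<and> T0 (r *\<^sub>R x) = r *\<^sub>R T0 x"
proof -
  from assms obtain f g where h: "f \<in> Lpos" "g \<in> Lneg" "x = Pp f + Pm g" "T0 x = Pm f + Pp g"
    by (metis dom0E)
  have "r *\<^sub>R x = Pp (r *\<^sub>R f) + Pm (r *\<^sub>R g)" by (simp add: h Pp_simps Pm_simps scaleR_add_right)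
  then show ?thesis
    using dom0I[of "r *\<^sub>R f" "r *\<^sub>R g"] T0_eq[of "r *\<^sub>R f" "r *\<^sub>R g"] h
    by (simp add: Lpos_closed Lneg_closed Pp_simps Pm_simps scaleR_add_right)
qed

lemma dom0_mult_i: assumes "x \<in> dom0"
  shows "mult_i x \<in> dom0 \<and> T0 (mult_i x) = mult_i (T0 x)"
proof -
  from assms obtain f g where h: "f \<in> Lpos" "g \<in> Lneg" "x = Pp f + Pm g" "T0 x = Pm f + Pp g"
    by (metis dom0E)
  have "mult_i x = Pp (mult_i f) + Pm (mult_i g)" by (simp add: h Pp_simps Pm_simps)
  then show ?thesis
    using dom0I[of "mult_i f" "mult_i g"] T0_eq[of "mult_i f" "mult_i g"] h
    by (simp add: Lpos_closed Lneg_closed Pp_simps Pm_simps)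
qed

lemma dom0_J: assumes "x \<in> dom0"
  shows "J x \<in> dom0 \<and> T0 (J x) = - J (T0 x)"
proof -
  from assms obtain f g where h: "f \<in> Lpos" "g \<in> Lneg" "x = Pp f + Pm g" "T0 x = Pm f + Pp g"
    by (metis dom0E)
  have m: "- g \<in> Lneg" using Lneg_closed(4)[OF h(2), of "-1"] by simp
  have Jx: "J x = Pp f + Pm (- g)" by (simp add: h(3) J_simps Pm_simps)
  have JT: "J (T0 x) = Pp g - Pm f" by (simp add: h(4) J_simps)
  show ?thesis
    unfolding JT unfolding Jx using dom0I[OF h(1) m] T0_eq[OF h(1) m] by (simp add: Pp_simps)
qed

lemma dom0_subspace: "subspace dom0"
proof -
  have "0 \<in> dom0" using dom0I[OF Lpos_closed(1) Lneg_closed(1)] by (simp add: Pp_simps Pm_simps)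
  then show ?thesis using dom0_add dom0_scale by (auto simp: subspace_def)
qed

text \<open>The identity \<open>[f, g] = 0\<close> for \<open>f \<in> Lpos\<close> and \<open>g \<in> Lneg\<close> says \<open>(Pm f, Pm g) = (Pp f, Pp g)\<close>, which
  is what makes \<open>T0\<close> symmetric.\<close>

lemma T0_sym: assumes "x \<in> dom0" "y \<in> dom0"
  shows "inner (T0 x) y = inner x (T0 y)"
proof -
  have same: "inner (Pm f) (Pm g) = inner (Pp f) (Pp g)" if "f \<in> Lpos" "g \<in> Lneg" for f g
  proof -
    have "inner (Pp f - Pm f) (Pp g + Pm g) = 0" using L_orthogonal[OF that] by (simp add: J_eq P_sum)
    then show ?thesis
      using plus_minus_orthogonal[of "Pp f" "Pm g"] plus_minus_orthogonal[of "Pp g" "Pm f"]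
      by (simp add: inner_add inner_diff inner_commute)
  qed
  from assms obtain f g f' g' where h: "f \<in> Lpos" "g \<in> Lneg" "x = Pp f + Pm g" "T0 x = Pm f + Pp g"
    "f' \<in> Lpos" "g' \<in> Lneg" "y = Pp f' + Pm g'" "T0 y = Pm f' + Pp g'" by (metis dom0E)
  have o: "inner (Pp u) (Pm v) = 0" "inner (Pm v) (Pp u) = 0" for u v
    using plus_minus_orthogonal[of "Pp u" "Pm v"] by (simp_all add: inner_commute)
  show ?thesis
    using same[OF h(1) h(6)] same[OF h(5) h(2)] unfolding h(4,8) unfolding h(3,7)
    by (simp add: inner_add o inner_commute)
qed

lemma T0_contraction: assumes "x \<in> dom0" shows "norm (T0 x) \<le> norm x"
proof -
  from assms obtain f g where h: "f \<in> Lpos" "g \<in> Lneg" "x = Pp f + Pm g" "T0 x = Pm f + Pp g"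
    by (metis dom0E)
  have o: "inner (Pp u) (Pm v) = 0" "inner (Pm v) (Pp u) = 0" for u v
    using plus_minus_orthogonal[of "Pp u" "Pm v"] by (simp_all add: inner_commute)
  have J_form: "inner (J u) u = inner (Pp u) (Pp u) - inner (Pm u) (Pm u)" for u
  proof -
    have "inner (J u) u = inner (Pp u - Pm u) (Pp u + Pm u)" unfolding J_eq[of u] P_sum ..
    then show ?thesis by (simp add: inner_add inner_diff o)
  qed
  have "0 \<le> inner (J f) f"
    using Lpos_pos[OF h(1)] by (cases "f = 0") auto
  moreover have "inner (J g) g \<le> 0"
    using Lneg_neg[OF h(2)] by (cases "g = 0") auto
  ultimately have "inner (T0 x) (T0 x) \<le> inner x x"
    unfolding h(4) unfolding h(3) J_form by (simp add: inner_add o)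
  then show ?thesis by (simp add: norm_le)
qed

lemma extensionsD:
  assumes "T \<in> extensions"
  shows "selfadjoint T" "norm (T x) \<le> norm x" "y \<in> dom0 \<Longrightarrow> T y = T0 y"
  using assms by (auto simp: sa_contractive_extensions_def)

lemma extension_form_nonneg:
  assumes "T \<in> extensions"
  shows "0 \<le> inner (x + T x) x" "0 \<le> inner (x - T x) x"
  using contraction_form_bound[of T x, OF extensionsD(2)[OF assms]]
  by (simp_all add: inner_add_left inner_diff_left power2_norm_eq_inner)

text \<open>Since \<open>T0\<close> is a contraction, \<open>\<parallel>(1 + T0) y\<parallel>\<^sup>2 \<le> 2 ((1 + T0) y, y)\<close>. The smallest positive extension \<open>A\<close>
  of \<open>1 + T0\<close> therefore satisfies \<open>0 \<le> A \<le> 2\<close>, and \<open>A - 1\<close> is a contraction.\<close>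

lemma minimal_extension_exists:
  "\<exists>T\<in>extensions. \<forall>x. \<forall>e>0. \<exists>y\<in>dom0. inner ((x - y) + T (x - y)) (x - y) < e"
proof -
  define S0 where "S0 y = y + T0 y" for y
  have bound: "(norm (S0 y))^2 \<le> 2 * inner (S0 y) y" if y: "y \<in> dom0" for y
  proof -
    have "inner (T0 y) (T0 y) \<le> inner y y" using T0_contraction[OF y] by (simp add: norm_le)
    then show ?thesis
      by (simp add: S0_def power2_norm_eq_inner inner_add inner_commute)
  qed
  have sym: "inner (S0 y) z = inner y (S0 z)" if "y \<in> dom0" "z \<in> dom0" for y z
    using T0_sym[OF that] by (simp add: S0_def inner_add)
  have "S0 (y + z) = S0 y + S0 z" if "y \<in> dom0" "z \<in> dom0" for y z
    using dom0_add[OF that] by (simp add: S0_def)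
  moreover have "S0 (r *\<^sub>R y) = r *\<^sub>R S0 y" "S0 (mult_i y) = mult_i (S0 y)" "mult_i y \<in> dom0"
    if "y \<in> dom0" for r y
    using dom0_scale[OF that] dom0_mult_i[OF that] by (simp_all add: S0_def scaleR_add_right)
  ultimately obtain A where A: "selfadjoint A"
    "\<And>x. 0 \<le> inner (A x) x" "\<And>x. inner (A x) x \<le> 2 * (norm x)^2" "\<And>y. y \<in> dom0 \<Longrightarrow> A y = S0 y"
    "\<And>x e. e > 0 \<Longrightarrow> \<exists>y\<in>dom0. inner (A (x - y)) (x - y) < e"
    using smallest_positive_extension[of dom0 S0 2, OF dom0_subspace _ _ _ _ sym bound] by auto
  define T where "T x = A x - x" for x
  have "selfadjoint T" unfolding T_def by (intro selfadjoint_diff A selfadjoint_id)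
  moreover have "norm (T x) \<le> norm x" for x
  proof (rule selfadjoint_contraction[OF \<open>selfadjoint T\<close>])
    show "\<bar>inner (T x) x\<bar> \<le> (norm x)^2" for x
      using A(2,3)[of x] by (simp add: T_def inner_diff_left power2_norm_eq_inner)
  qed
  moreover have "T y = T0 y" if "y \<in> dom0" for y using A(4)[OF that] by (simp add: T_def S0_def)
  ultimately have "T \<in> extensions" by (simp add: sa_contractive_extensions_def)
  moreover have "x + T x = A x" for x by (simp add: T_def)
  ultimately show ?thesis using A(5) by (intro bexI[of _ T]) auto
qed

text \<open>The form of \<open>T - Tm\<close> takes the same value at \<open>x\<close> as at \<open>x - y\<close>, where \<open>1 + T\<close> is nonnegative and
  \<open>1 + Tm\<close> can be made arbitrarily small.\<close>

lemma minimal_extension_le: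
  assumes Tm: "Tm \<in> extensions" "\<And>x e. e > 0 \<Longrightarrow> \<exists>y\<in>dom0. inner ((x - y) + Tm (x - y)) (x - y) < e"
    and T: "T \<in> extensions"
  shows "op_le Tm T"
  unfolding op_le_iff
proof
  fix x
  define C where "C x = T x - Tm x" for x
  have C: "selfadjoint C" unfolding C_def by (intro selfadjoint_diff extensionsD Tm T)
  have "- inner (C x) x \<le> e" if "e > 0" for e
  proof -
    obtain y where y: "y \<in> dom0" "inner ((x - y) + Tm (x - y)) (x - y) < e" using Tm(2) \<open>e > 0\<close> by blast
    have "C y = 0" using y(1) extensionsD(3)[OF T] extensionsD(3)[OF Tm(1)] by (simp add: C_def)
    from form_shift[OF C this, of x] show ?thesis
      using y(2) extension_form_nonneg(1)[OF T, of "x - y"] by (simp add: C_def inner_add_left inner_diff_left)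
  qed
  then have "- inner (C x) x \<le> 0" using field_le_epsilon[of "- inner (C x) x" 0] by simp
  then show "inner (Tm x) x \<le> inner (T x) x" by (simp add: C_def inner_diff_left)
qed

definition reflect :: "('a \<Rightarrow> 'a) \<Rightarrow> 'a \<Rightarrow> 'a" where
  "reflect T x = - J (T (J x))"

lemma reflect_reflect: "reflect (reflect T) = T"
  by (simp add: reflect_def fun_eq_iff J_simps)

text \<open>\<open>T0\<close> anticommutes with \<open>J\<close>, so reflection permutes the extensions; it reverses the order, and
  therefore the largest extension is the reflection of the smallest one.\<close>

lemma reflect_extension:
  assumes T: "T \<in> extensions"
  shows "reflect T \<in> extensions"
proof -
  have "selfadjoint (\<lambda>x. (-1) *\<^sub>R J (T (J x)))"
    using selfadjoint_scaleR[OF selfadjoint_sandwich[OF J_selfadjoint extensionsD(1)[OF T]]] .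
  then have "selfadjoint (reflect T)" by (simp add: reflect_def[abs_def])
  moreover have "norm (reflect T x) \<le> norm x" for x
    using extensionsD(2)[OF T, of "J x"] by (simp add: reflect_def)
  moreover have "reflect T y = T0 y" if "y \<in> dom0" for y
    using dom0_J[OF that] extensionsD(3)[OF T, of "J y"] by (simp add: reflect_def J_simps)
  ultimately show ?thesis by (simp add: sa_contractive_extensions_def)
qed

lemma op_le_reflect: "op_le A B \<Longrightarrow> op_le (reflect B) (reflect A)"
  by (simp add: op_le_iff reflect_def J_sym)

text \<open>An operator between the two end points is a contraction as both are. On \<open>dom0\<close> the end points
  agree, so the form of \<open>T - Tm \<ge> 0\<close> vanishes there, and with it \<open>T - Tm\<close> itself.\<close>

theorem extensions_interval:
  assumes Tm: "Tm \<in> extensions" "\<And>x e. e > 0 \<Longrightarrow> \<exists>y\<in>dom0. inner ((x - y) + Tm (x - y)) (x - y) < e"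
  shows "extensions = operator_interval Tm (reflect Tm)"
proof (intro set_eqI iffI)
  fix T assume T: "T \<in> extensions"
  have "op_le T (reflect Tm)"
    using op_le_reflect[OF minimal_extension_le[OF Tm reflect_extension[OF T]]] by (simp add: reflect_reflect)
  then show "T \<in> operator_interval Tm (reflect Tm)"
    using minimal_extension_le[OF Tm T] extensionsD(1)[OF T] by (simp add: operator_interval_def)
next
  fix T assume "T \<in> operator_interval Tm (reflect Tm)"
  then have T: "selfadjoint T" "\<And>x. inner (Tm x) x \<le> inner (T x) x" "\<And>x. inner (T x) x \<le> inner (reflect Tm x) x"
    by (auto simp: operator_interval_def op_le_iff)
  note TM = reflect_extension[OF Tm(1)]
  have "norm (T x) \<le> norm x" for x
  proof (rule selfadjoint_contraction[OF T(1)])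
    fix x
    show "\<bar>inner (T x) x\<bar> \<le> (norm x)^2"
      using T(2,3)[of x] contraction_form_bound[of Tm x, OF extensionsD(2)[OF Tm(1)]]
        contraction_form_bound[of "reflect Tm" x, OF extensionsD(2)[OF TM]] by linarith
  qed
  moreover have "T y = T0 y" if y: "y \<in> dom0" for y
  proof -
    have eq: "reflect Tm y = T0 y" "Tm y = T0 y"
      using extensionsD(3)[OF TM y] extensionsD(3)[OF Tm(1) y] by auto
    have "T y - Tm y = 0"
    proof (rule positive_form_zero[where A = "\<lambda>x. T x - Tm x"])
      show "selfadjoint (\<lambda>x. T x - Tm x)" by (intro selfadjoint_diff T extensionsD Tm)
      show "0 \<le> inner (T x - Tm x) x" for x using T(2)[of x] by (simp add: inner_diff_left)
      show "inner (T y - Tm y) y = 0" using T(2,3)[of y] eq by (simp add: inner_diff_left)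
    qed
    then show ?thesis using eq by simp
  qed
  ultimately show "T \<in> extensions" using T(1) by (simp add: sa_contractive_extensions_def)
qed

abbreviation "Tmu \<equiv> T_mu J Lpos Lneg"
abbreviation "TM \<equiv> T_M J Lpos Lneg"

lemma
  shows T_mu_extension: "Tmu \<in> extensions"
    and T_mu_infimum: "e > 0 \<Longrightarrow> \<exists>y\<in>dom0. inner ((x - y) + Tmu (x - y)) (x - y) < e"
    and T_M_eq: "TM = reflect Tmu"
proof -
  obtain Tm where Tm: "Tm \<in> extensions"
    "\<And>x e. e > 0 \<Longrightarrow> \<exists>y\<in>dom0. inner ((x - y) + Tm (x - y)) (x - y) < e"
    using minimal_extension_exists by blast
  note sa = extensionsD(1)[OF Tm(1)] extensionsD(1)[OF reflect_extension[OF Tm(1)]]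
  note I = extensions_interval[OF Tm]
  have "extension_endpoints J Lpos Lneg = (Tm, reflect Tm)"
    unfolding extension_endpoints_def
  proof (rule the_equality)
    show "case (Tm, reflect Tm) of (A, B) \<Rightarrow>
        selfadjoint A \<and> selfadjoint B \<and> extensions = operator_interval A B"
      using sa I by simp
    fix p assume p: "case p of (A, B) \<Rightarrow> selfadjoint A \<and> selfadjoint B \<and> extensions = operator_interval A B"
    obtain A B where AB: "p = (A, B)" by fastforce
    show "p = (Tm, reflect Tm)"
      using operator_interval_endpoints_unique[of Tm "reflect Tm" A B] p sa I Tm(1) unfolding AB by auto
  qed
  then have "Tmu = Tm" "TM = reflect Tm" by (simp_all add: T_mu_def T_M_def)
  then show "Tmu \<in> extensions" "TM = reflect Tmu"
    "e > 0 \<Longrightarrow> \<exists>y\<in>dom0. inner ((x - y) + Tmu (x - y)) (x - y) < e" using Tm by auto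
qed

lemma T_M_extension: "TM \<in> extensions"
  unfolding T_M_eq by (rule reflect_extension[OF T_mu_extension])

lemma extensions_eq: "extensions = operator_interval Tmu TM"
  unfolding T_M_eq by (rule extensions_interval[OF T_mu_extension T_mu_infimum])

lemma T_M_infimum:
  assumes "e > 0"
  shows "\<exists>y\<in>dom0. inner ((x - y) - TM (x - y)) (x - y) < e"
proof -
  obtain y where y: "y \<in> dom0" "inner ((J x - y) + Tmu (J x - y)) (J x - y) < e"
    using T_mu_infimum[OF assms] by blast
  have "inner ((x - J y) - TM (x - J y)) (x - J y) = inner ((J x - y) + Tmu (J x - y)) (J x - y)"
    by (simp add: T_M_eq reflect_def inner_diff inner_add J_simps J_sym selfadjointD(5)[OF extensionsD(1)[OF T_mu_extension]])
  then show ?thesis using y dom0_J by (intro bexI[of _ "J y"]) auto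
qed

end

section \<open>Density in a completion\<close>

text \<open>The factor 2 in the Cauchy--Schwarz inequality lets it be derived from bounds on the real and
  imaginary parts separately; only the convergence of \<open>g (X k) (Y k)\<close> depends on it.\<close>

locale semi_inner_on =
  fixes S :: "'a::ab_group_add set" and g :: "'a \<Rightarrow> 'a \<Rightarrow> complex"
  assumes diff_mem: "x \<in> S \<Longrightarrow> y \<in> S \<Longrightarrow> x - y \<in> S"
    and diff_left: "x \<in> S \<Longrightarrow> y \<in> S \<Longrightarrow> z \<in> S \<Longrightarrow> g (x - y) z = g x z - g y z"
    and diff_right: "x \<in> S \<Longrightarrow> y \<in> S \<Longrightarrow> z \<in> S \<Longrightarrow> g z (x - y) = g z x - g z y"
    and self_real: "x \<in> S \<Longrightarrow> Im (g x x) = 0"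
    and self_nonneg: "x \<in> S \<Longrightarrow> 0 \<le> Re (g x x)"
    and triangle: "x \<in> S \<Longrightarrow> y \<in> S \<Longrightarrow> ip_norm g (x - y) \<le> ip_norm g x + ip_norm g y"
    and bound: "x \<in> S \<Longrightarrow> y \<in> S \<Longrightarrow> cmod (g x y) \<le> 2 * ip_norm g x * ip_norm g y"
begin

abbreviation "nrm \<equiv> ip_norm g"

lemma nrm_nonneg: "x \<in> S \<Longrightarrow> 0 \<le> nrm x"
  by (simp add: ip_norm_def self_nonneg)

lemma g_self: "x \<in> S \<Longrightarrow> g x x = complex_of_real ((nrm x)^2)"
  by (rule complex_eqI) (simp_all add: ip_norm_def self_nonneg self_real)

lemma zero_mem: "x \<in> S \<Longrightarrow> 0 \<in> S"
  using diff_mem[of x x] by simp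

lemma nrm_commute: "x \<in> S \<Longrightarrow> y \<in> S \<Longrightarrow> nrm (x - y) = nrm (y - x)"
  by (simp add: ip_norm_def diff_left diff_right diff_mem)

lemma nrm_0: "x \<in> S \<Longrightarrow> nrm 0 = 0"
  using diff_left[of x x 0] zero_mem[of x] by (simp add: ip_norm_def)

lemma nrm_triangle3:
  assumes "x \<in> S" "y \<in> S" "z \<in> S"
  shows "nrm (x - z) \<le> nrm (x - y) + nrm (y - z)"
  using triangle[of "x - y" "z - y"] assms nrm_commute[of z y] by (simp add: diff_mem)

lemma nrm_reverse_triangle:
  assumes "x \<in> S" "y \<in> S"
  shows "\<bar>nrm x - nrm y\<bar> \<le> nrm (x - y)"
  using nrm_triangle3[of x y 0] nrm_triangle3[of y x 0] assms zero_mem[of x] nrm_commute[of x y] by simp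

lemma cauchy_seqsD: "X \<in> cauchy_seqs S g \<Longrightarrow> X k \<in> S"
  by (auto simp: cauchy_seqs_def)

lemma cauchy_seqs_bound:
  assumes "X \<in> cauchy_seqs S g" "e > 0"
  obtains N where "\<And>m n. m \<ge> N \<Longrightarrow> n \<ge> N \<Longrightarrow> nrm (X m - X n) < e"
proof -
  have "\<exists>N. \<forall>m\<ge>N. \<forall>n\<ge>N. nrm (X m - X n) < e" using assms by (simp add: cauchy_seqs_def)
  then show ?thesis using that by blast
qed

lemma const_cauchy: "f \<in> S \<Longrightarrow> (\<lambda>_. f) \<in> cauchy_seqs S g"
  by (auto simp: cauchy_seqs_def nrm_0)

lemma cauchy_diff:
  assumes X: "X \<in> cauchy_seqs S g" and Y: "Y \<in> cauchy_seqs S g"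
  shows "(\<lambda>k. X k - Y k) \<in> cauchy_seqs S g"
proof -
  note mem = cauchy_seqsD[OF X] cauchy_seqsD[OF Y]
  have "\<exists>N. \<forall>m\<ge>N. \<forall>n\<ge>N. nrm (X m - Y m - (X n - Y n)) < e" if e: "e > 0" for e :: real
  proof -
    obtain N1 where N1: "\<And>m n. m \<ge> N1 \<Longrightarrow> n \<ge> N1 \<Longrightarrow> nrm (X m - X n) < e / 2"
      using cauchy_seqs_bound[OF X, of "e / 2"] e by auto
    obtain N2 where N2: "\<And>m n. m \<ge> N2 \<Longrightarrow> n \<ge> N2 \<Longrightarrow> nrm (Y m - Y n) < e / 2"
      using cauchy_seqs_bound[OF Y, of "e / 2"] e by auto
    have "nrm (X m - Y m - (X n - Y n)) < e" if "m \<ge> max N1 N2" "n \<ge> max N1 N2" for m n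
    proof -
      have e: "X m - Y m - (X n - Y n) = (X m - X n) - (Y m - Y n)" by simp
      show ?thesis
        unfolding e using triangle[of "X m - X n" "Y m - Y n"] N1[of m n] N2[of m n] that mem
        by (simp add: diff_mem)
    qed
    then show ?thesis by blast
  qed
  then show ?thesis using mem by (auto simp: cauchy_seqs_def diff_mem)
qed

lemma equiv_null_rel: "equiv (cauchy_seqs S g) (null_rel S g)"
proof (rule equivI)
  show "null_rel S g \<subseteq> cauchy_seqs S g \<times> cauchy_seqs S g" by (auto simp: null_rel_def)
  show "refl_on (cauchy_seqs S g) (null_rel S g)"
    by (rule refl_onI) (auto simp: null_rel_def nrm_0[OF cauchy_seqsD])
  show "sym (null_rel S g)"
    by (rule symI) (auto simp: null_rel_def nrm_commute[OF cauchy_seqsD cauchy_seqsD])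
  show "trans (null_rel S g)"
  proof (rule transI)
    fix X Y Z assume "(X, Y) \<in> null_rel S g" "(Y, Z) \<in> null_rel S g"
    then have mem: "X \<in> cauchy_seqs S g" "Y \<in> cauchy_seqs S g" "Z \<in> cauchy_seqs S g"
      and l: "(\<lambda>k. nrm (X k - Y k)) \<longlonglongrightarrow> 0" "(\<lambda>k. nrm (Y k - Z k)) \<longlonglongrightarrow> 0"
      by (auto simp: null_rel_def)
    note memS = mem[THEN cauchy_seqsD]
    have "(\<lambda>k. nrm (X k - Z k)) \<longlonglongrightarrow> 0"
    proof (rule Lim_null_comparison)
      show "\<forall>\<^sub>F k in sequentially. norm (nrm (X k - Z k)) \<le> nrm (X k - Y k) + nrm (Y k - Z k)"
        using nrm_triangle3 memS by (simp add: nrm_nonneg diff_mem)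
      show "(\<lambda>k. nrm (X k - Y k) + nrm (Y k - Z k)) \<longlonglongrightarrow> 0" using tendsto_add[OF l] by simp
    qed
    with mem show "(X, Z) \<in> null_rel S g" by (auto simp: null_rel_def)
  qed
qed

lemma cauchy_nrm_convergent:
  assumes X: "X \<in> cauchy_seqs S g"
  shows "\<exists>l. (\<lambda>k. nrm (X k)) \<longlonglongrightarrow> l"
proof -
  have "Cauchy (\<lambda>k. nrm (X k))"
  proof (rule metric_CauchyI)
    fix e :: real assume "e > 0"
    then obtain N where "\<And>m n. m \<ge> N \<Longrightarrow> n \<ge> N \<Longrightarrow> nrm (X m - X n) < e"
      using cauchy_seqs_bound[OF X] by blast
    then show "\<exists>N. \<forall>m\<ge>N. \<forall>n\<ge>N. dist (nrm (X m)) (nrm (X n)) < e"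
      using nrm_reverse_triangle[OF cauchy_seqsD[OF X] cauchy_seqsD[OF X]]
      by (metis dist_real_def le_less_trans)
  qed
  then show ?thesis by (simp add: Cauchy_convergent_iff convergent_def)
qed

lemma null_rel_nrm_limit:
  assumes "(Z, X) \<in> null_rel S g" "(\<lambda>k. nrm (Z k)) \<longlonglongrightarrow> l"
  shows "(\<lambda>k. nrm (X k)) \<longlonglongrightarrow> l"
proof -
  from assms have mem: "\<And>k. Z k \<in> S" "\<And>k. X k \<in> S" and d: "(\<lambda>k. nrm (Z k - X k)) \<longlonglongrightarrow> 0"
    by (auto simp: null_rel_def cauchy_seqs_def)
  have "(\<lambda>k. nrm (Z k) - nrm (X k)) \<longlonglongrightarrow> 0"
    using nrm_reverse_triangle[OF mem] by (intro Lim_null_comparison[OF _ d]) auto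
  from tendsto_diff[OF assms(2) this] show ?thesis by simp
qed

text \<open>Replacing both arguments by equivalent sequences changes \<open>g (Z k) (Z k)\<close> by a null sequence.\<close>

lemma compl_inner_self:
  assumes Z: "Z \<in> cauchy_seqs S g" and l: "(\<lambda>k. nrm (Z k)) \<longlonglongrightarrow> l"
  shows "compl_inner g (null_rel S g `` {Z}) (null_rel S g `` {Z}) = complex_of_real (l^2)"
proof -
  let ?A = "null_rel S g `` {Z}"
  have ZA: "Z \<in> ?A" by (rule equiv_class_self[OF equiv_null_rel Z])
  have lim: "(\<lambda>k. g (X k) (Y k)) \<longlonglongrightarrow> complex_of_real (l^2)" if "X \<in> ?A" "Y \<in> ?A" for X Y
  proof -
    from that have rel: "(Z, X) \<in> null_rel S g" "(Z, Y) \<in> null_rel S g" by auto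
    then have mem: "\<And>k. Z k \<in> S" "\<And>k. X k \<in> S" "\<And>k. Y k \<in> S"
      and d: "(\<lambda>k. nrm (Z k - X k)) \<longlonglongrightarrow> 0" "(\<lambda>k. nrm (Z k - Y k)) \<longlonglongrightarrow> 0"
      by (auto simp: null_rel_def cauchy_seqs_def)
    have "(\<lambda>k. g (X k) (Y k) - g (Z k) (Z k)) \<longlonglongrightarrow> 0"
    proof (rule Lim_null_comparison)
      have "norm (g (X k) (Y k) - g (Z k) (Z k))
        \<le> 2 * nrm (X k) * nrm (Z k - Y k) + 2 * nrm (Z k - X k) * nrm (Z k)" for k
      proof -
        have "g (X k) (Y k) - g (Z k) (Z k) = g (X k) (Y k - Z k) + g (X k - Z k) (Z k)"
          by (simp add: diff_left diff_right mem)
        also have "norm \<dots> \<le> cmod (g (X k) (Y k - Z k)) + cmod (g (X k - Z k) (Z k))"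
          by (rule norm_triangle_ineq)
        also have "\<dots> \<le> 2 * nrm (X k) * nrm (Y k - Z k) + 2 * nrm (X k - Z k) * nrm (Z k)"
          by (intro add_mono bound diff_mem mem)
        finally show ?thesis using nrm_commute[OF mem(3) mem(1)] nrm_commute[OF mem(2) mem(1)] by simp
      qed
      then show "\<forall>\<^sub>F k in sequentially. norm (g (X k) (Y k) - g (Z k) (Z k))
        \<le> 2 * nrm (X k) * nrm (Z k - Y k) + 2 * nrm (Z k - X k) * nrm (Z k)" by simp
      have "(\<lambda>k. 2 * nrm (X k) * nrm (Z k - Y k) + 2 * nrm (Z k - X k) * nrm (Z k))
        \<longlonglongrightarrow> 2 * l * 0 + 2 * 0 * l"
        by (intro tendsto_intros d l null_rel_nrm_limit[OF rel(1) l])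
      then show "(\<lambda>k. 2 * nrm (X k) * nrm (Z k - Y k) + 2 * nrm (Z k - X k) * nrm (Z k)) \<longlonglongrightarrow> 0"
        by simp
    qed
    moreover have "(\<lambda>k. g (Z k) (Z k)) \<longlonglongrightarrow> complex_of_real (l^2)"
      unfolding g_self[OF mem(1)] by (intro tendsto_intros l)
    ultimately show ?thesis using tendsto_add by fastforce
  qed
  show ?thesis
    unfolding compl_inner_def
    by (rule the_equality) (use lim ZA LIMSEQ_unique in blast)+
qed

lemma compl_diff_embed:
  assumes X: "X \<in> cauchy_seqs S g" and f: "f \<in> S"
  shows "compl_diff S g (null_rel S g `` {X}) (compl_embed S g f) = null_rel S g `` {\<lambda>k. X k - f}"
proof -
  let ?f = "\<lambda>_::nat. f"
  have same: "null_rel S g `` {\<lambda>k. X' k - Y' k} = null_rel S g `` {\<lambda>k. X k - f}"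
    if X': "(X, X') \<in> null_rel S g" and Y': "(?f, Y') \<in> null_rel S g" for X' Y'
  proof (rule equiv_class_eq[OF equiv_null_rel])
    have mem: "X' \<in> cauchy_seqs S g" "Y' \<in> cauchy_seqs S g"
      and d: "(\<lambda>k. nrm (X k - X' k)) \<longlonglongrightarrow> 0" "(\<lambda>k. nrm (f - Y' k)) \<longlonglongrightarrow> 0"
      using X' Y' by (auto simp: null_rel_def)
    note memS = mem[THEN cauchy_seqsD] cauchy_seqsD[OF X]
    have "(\<lambda>k. nrm (X' k - Y' k - (X k - f))) \<longlonglongrightarrow> 0"
    proof (rule Lim_null_comparison)
      have "nrm (X' k - Y' k - (X k - f)) \<le> nrm (X k - X' k) + nrm (f - Y' k)" for k
      proof -
        have e: "X' k - Y' k - (X k - f) = (f - Y' k) - (X k - X' k)" by simp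
        show ?thesis
          unfolding e using triangle[of "f - Y' k" "X k - X' k"] by (simp add: memS f diff_mem)
      qed
      then show "\<forall>\<^sub>F k in sequentially. norm (nrm (X' k - Y' k - (X k - f)))
          \<le> nrm (X k - X' k) + nrm (f - Y' k)"
        by (simp add: nrm_nonneg diff_mem memS f)
      show "(\<lambda>k. nrm (X k - X' k) + nrm (f - Y' k)) \<longlonglongrightarrow> 0" using tendsto_add[OF d] by simp
    qed
    then show "(\<lambda>k. X' k - Y' k, \<lambda>k. X k - f) \<in> null_rel S g"
      using cauchy_diff[OF mem] cauchy_diff[OF X const_cauchy[OF f]] by (auto simp: null_rel_def)
  qed
  have "X \<in> null_rel S g `` {X}" "?f \<in> null_rel S g `` {?f}"
    using equiv_class_self[OF equiv_null_rel] X const_cauchy[OF f] by auto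
  then show ?thesis unfolding compl_diff_def compl_embed_def using same by blast
qed

text \<open>The distance in the completion from the class of \<open>X\<close> to \<open>f\<close> is the limit of \<open>nrm (X k - f)\<close>;
  a Cauchy sequence is close to its late terms, so it is enough to approximate elements of \<open>S\<close>.\<close>

theorem dense_in_completion_iff:
  assumes D: "D \<subseteq> S"
  shows "dense_in_completion S g D \<longleftrightarrow> (\<forall>s\<in>S. \<forall>e>0. \<exists>f\<in>D. nrm (s - f) < e)"
proof -
  have dist: "ip_norm (compl_inner g) (compl_diff S g (null_rel S g `` {X}) (compl_embed S g f)) = l"
    if X: "X \<in> cauchy_seqs S g" and f: "f \<in> S" and l: "(\<lambda>k. nrm (X k - f)) \<longlonglongrightarrow> l" for X f l
  proof -
    have "0 \<le> l" using l by (rule LIMSEQ_le_const) (auto simp: nrm_nonneg diff_mem cauchy_seqsD[OF X] f)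
    then show ?thesis
      unfolding compl_diff_embed[OF X f] ip_norm_def[of "compl_inner g"]
        compl_inner_self[OF cauchy_diff[OF X const_cauchy[OF f]] l] by simp
  qed
  show ?thesis
  proof
    assume dense: "dense_in_completion S g D"
    show "\<forall>s\<in>S. \<forall>e>0. \<exists>f\<in>D. nrm (s - f) < e"
    proof (intro ballI allI impI)
      fix s and e :: real assume s: "s \<in> S" and e: "e > 0"
      have "null_rel S g `` {\<lambda>_. s} \<in> completion S g"
        unfolding completion_def by (intro quotientI const_cauchy s)
      then obtain f where "f \<in> D"
        "ip_norm (compl_inner g) (compl_diff S g (null_rel S g `` {\<lambda>_. s}) (compl_embed S g f)) < e"
        using dense e unfolding dense_in_completion_def by blast
      then show "\<exists>f\<in>D. nrm (s - f) < e"
        using dist[OF const_cauchy[OF s] _ tendsto_const, of f] D by (metis subsetD)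
    qed
  next
    assume approx: "\<forall>s\<in>S. \<forall>e>0. \<exists>f\<in>D. nrm (s - f) < e"
    show "dense_in_completion S g D"
      unfolding dense_in_completion_def
    proof (intro ballI allI impI)
      fix A and e :: real assume "A \<in> completion S g" and e: "e > 0"
      then obtain X where X: "X \<in> cauchy_seqs S g" and A: "A = null_rel S g `` {X}"
        unfolding completion_def by (auto elim: quotientE)
      obtain N where N: "\<And>m n. m \<ge> N \<Longrightarrow> n \<ge> N \<Longrightarrow> nrm (X m - X n) < e / 3"
        using cauchy_seqs_bound[OF X, of "e / 3"] e by auto
      obtain f where f: "f \<in> D" "nrm (X N - f) < e / 3"
        using approx e cauchy_seqsD[OF X, of N] by (metis zero_less_divide_iff zero_less_numeral)
      have fS: "f \<in> S" using f D by blast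
      obtain l where l: "(\<lambda>k. nrm (X k - f)) \<longlonglongrightarrow> l"
        using cauchy_nrm_convergent[OF cauchy_diff[OF X const_cauchy[OF fS]]] by blast
      have "nrm (X k - f) \<le> 2 * e / 3" if "k \<ge> N" for k
        using nrm_triangle3[of "X k" "X N" f] cauchy_seqsD[OF X] fS N[OF that, of N] f by simp
      then have "l \<le> 2 * e / 3" using l by (intro LIMSEQ_le_const2) auto
      also have "\<dots> < e" using e by simp
      finally show "\<exists>f\<in>D. ip_norm (compl_inner g) (compl_diff S g A (compl_embed S g f)) < e"
        using dist[OF X fS l] f(1) A by blast
    qed
  qed
qed

end

section \<open>The dual maximal definite subspaces of an anticommuting extension\<close>

locale anticommuting_extension = dual_definite_pair J Lpos Lneg
  for J :: "'a::chilbert_space \<Rightarrow> 'a" and Lpos Lneg +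
  fixes T :: "'a \<Rightarrow> 'a"
  assumes dense: "closure (alg_sum Lpos Lneg) = UNIV"
    and T_ext: "T \<in> extensions"
    and J_T: "J (T x) = - T (J x)"
begin

lemma T_selfadjoint: "selfadjoint T"
  and T_contraction: "norm (T x) \<le> norm x"
  and T_eq_T0: "y \<in> dom0 \<Longrightarrow> T y = T0 y"
  using extensionsD[OF T_ext] by auto

lemmas T_simps = selfadjointD(2,4-8)[OF T_selfadjoint]
lemmas T_sym = selfadjointD(3)[OF T_selfadjoint]

abbreviation Lmax_pos :: "'a set" where "Lmax_pos \<equiv> (\<lambda>x. x + T x) ` {x. J x = x}"
abbreviation Lmax_neg :: "'a set" where "Lmax_neg \<equiv> (\<lambda>x. x + T x) ` {x. J x = - x}"

lemma alg_sum_eq: "alg_sum Lpos Lneg = (\<lambda>y. y + T y) ` dom0"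
proof -
  have "Pp f + Pm g + T (Pp f + Pm g) = f + g" if "f \<in> Lpos" "g \<in> Lneg" for f g
    using P_sum[of f] P_sum[of g] T_eq_T0[OF dom0I[OF that]] T0_eq[OF that]
    by (metis (no_types, opaque_lifting) add.assoc add.left_commute add.commute)
  then show ?thesis by (force simp: alg_sum_def dom0_eq image_def)
qed

text \<open>The kernel of \<open>1 + T\<close> is orthogonal to \<open>(1 + T) dom0 = Lpos + Lneg\<close>, which is dense.\<close>

lemma T_plus_injective:
  assumes "x + T x = 0"
  shows "x = 0"
proof (rule orthogonal_dense_imp_0[OF dense])
  fix h assume "h \<in> alg_sum Lpos Lneg"
  then obtain y where "h = y + T y" unfolding alg_sum_eq by blast
  then have "inner x h = inner (x + T x) y" by (simp add: inner_add T_sym)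
  then show "inner x h = 0" using assms by simp
qed

text \<open>Equality of norms would give \<open>(1 - T\<^sup>2) x = (1 + T) (1 - T) x = 0\<close>. As \<open>J\<close> intertwines \<open>1 - T\<close> with
  \<open>1 + T\<close>, both factors are injective.\<close>

lemma T_strict: assumes "x \<noteq> 0" shows "norm (T x) < norm x"
proof (rule ccontr)
  assume "\<not> ?thesis"
  then have eq: "norm (T x) = norm x" using T_contraction[of x] by simp
  have "selfadjoint (\<lambda>x. x - T (T x))"
    using selfadjoint_diff[OF selfadjoint_id selfadjoint_sandwich[OF T_selfadjoint selfadjoint_id]] .
  moreover have "0 \<le> inner (x - T (T x)) x" for x
    using T_contraction[of x] by (simp add: inner_diff_left T_sym norm_le)
  moreover have "inner (x - T (T x)) x = 0"
    using eq by (simp add: inner_diff_left T_sym norm_eq)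
  ultimately have "x - T (T x) = 0" by (rule positive_form_zero)
  then have "(x - T x) + T (x - T x) = 0" by (simp add: T_simps)
  then have "x - T x = 0" by (rule T_plus_injective)
  then have "J x + T (J x) = 0" using J_T[of x] by (simp add: eq_neg_iff_add_eq_0[symmetric])
  then have "J x = 0" by (rule T_plus_injective)
  then have "x = 0" by (metis J_J J_simps(5))
  with assms show False by simp
qed

lemma J_T_plus: "J x = x \<Longrightarrow> J (T x) = - T x" and J_T_minus: "J x = - x \<Longrightarrow> J (T x) = T x"
  by (simp_all add: J_T T_simps)

lemma Lmax_pos_eq: "Lmax_pos = {f. Pp f + T (Pp f) = f}"
proof (intro set_eqI iffI)
  fix f assume "f \<in> Lmax_pos"
  then obtain x where "J x = x" "f = x + T x" by blast
  then show "f \<in> {f. Pp f + T (Pp f) = f}"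
    using J_T_plus[of x] by (simp add: Pp_simps P_of_plus P_of_minus)
next
  fix f assume "f \<in> {f. Pp f + T (Pp f) = f}"
  then show "f \<in> Lmax_pos" by (intro image_eqI[of _ _ "Pp f"]) auto
qed

lemma Lmax_neg_eq: "Lmax_neg = {f. Pm f + T (Pm f) = f}"
proof (intro set_eqI iffI)
  fix f assume "f \<in> Lmax_neg"
  then obtain x where "J x = - x" "f = x + T x" by blast
  then show "f \<in> {f. Pm f + T (Pm f) = f}"
    using J_T_minus[of x] by (simp add: Pm_simps P_of_plus P_of_minus)
next
  fix f assume "f \<in> {f. Pm f + T (Pm f) = f}"
  then show "f \<in> Lmax_neg" by (intro image_eqI[of _ _ "Pm f"]) auto
qed

lemma Lmax_subspace: "closed_csubspace Lmax_pos" "closed_csubspace Lmax_neg"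
  unfolding Lmax_pos_eq Lmax_neg_eq
  by (intro fixed_point_subspace bounded_linear_add bounded_linear_compose[OF selfadjointD(1)[OF T_selfadjoint]]
      selfadjointD(1) P_plus_selfadjoint P_minus_selfadjoint; simp add: Pp_simps Pm_simps T_simps)+

lemma indef_pos:
  assumes "J x = x" "J y = y"
  shows "inner (J (x + T x)) (y + T y) = inner x y - inner (T x) (T y)"
  using assms J_T_plus[of x] by (simp add: J_simps inner_add inner_diff T_sym)

lemma indef_neg:
  assumes "J x = - x" "J y = - y"
  shows "inner (J (x + T x)) (y + T y) = - (inner x y - inner (T x) (T y))"
  using assms J_T_minus[of x] by (simp add: J_simps inner_add inner_diff T_sym)

lemma indef_pos_neg:
  assumes "J x = x" "J y = - y"
  shows "inner (J (x + T x)) (y + T y) = 0"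
proof -
  have "inner x y = 0" "inner (T x) (T y) = 0"
    using plus_minus_orthogonal[of x y] plus_minus_orthogonal[of "T y" "T x"] assms J_T_plus J_T_minus
    by (simp_all add: inner_commute)
  moreover have "inner (J (x + T x)) (y + T y) = inner x y - inner (T x) (T y)"
    using assms J_T_plus[of x] T_sym[of x y] by (simp add: J_simps inner_add inner_diff)
  ultimately show ?thesis by simp
qed

lemma Lmax_positive: "positive_subspace J Lmax_pos"
proof -
  have "0 < inner (J f) f" if f: "f \<in> Lmax_pos" "f \<noteq> 0" for f
  proof -
    obtain x where x: "J x = x" "f = x + T x" using f by blast
    then have "x \<noteq> 0" using f(2) T_simps(5) by auto
    from T_strict[OF this] have "inner (T x) (T x) < inner x x" by (simp add: norm_lt)
    then show ?thesis by (simp add: x indef_pos)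
  qed
  then show ?thesis
    using Lmax_subspace by (simp add: positive_subspace_def indef_def Re_cinner)
qed

lemma Lmax_negative: "negative_subspace J Lmax_neg"
proof -
  have "inner (J f) f < 0" if f: "f \<in> Lmax_neg" "f \<noteq> 0" for f
  proof -
    obtain x where x: "J x = - x" "f = x + T x" using f by blast
    then have "x \<noteq> 0" using f(2) T_simps(5) by auto
    from T_strict[OF this] have "inner (T x) (T x) < inner x x" by (simp add: norm_lt)
    then show ?thesis unfolding x(2) indef_neg[OF x(1) x(1)] by simp
  qed
  then show ?thesis
    using Lmax_subspace by (simp add: negative_subspace_def indef_def Re_cinner)
qed

text \<open>Since \<open>Lmax_pos\<close> projects onto the whole positive part of the space, a strictly larger positive
  subspace would contain a nonzero vector of the negative part.\<close>

lemma Lmax_maximal_positive: "maximal_positive J Lmax_pos"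
proof -
  have "L' \<subseteq> Lmax_pos" if L': "positive_subspace J L'" "Lmax_pos \<subseteq> L'" for L'
  proof
    fix f assume f: "f \<in> L'"
    have csub: "closed_csubspace L'" using L' by (simp add: positive_subspace_def)
    define d where "d = f - (Pp f + T (Pp f))"
    have "d \<in> L'" unfolding d_def
      using L'(2) f by (intro closed_csubspaceD(3)[OF csub]) auto
    moreover have "d = Pm f - T (Pp f)" unfolding d_def using P_sum[of f] by (simp add: algebra_simps)
    then have "J d = - d" using J_T_plus[of "Pp f"] by (simp add: J_simps)
    ultimately have "d = 0"
      using L'(1) inner_ge_zero[of d]
      by (auto simp: positive_subspace_def indef_def Re_cinner simp del: inner_ge_zero)
    then show "f \<in> Lmax_pos" by (simp add: Lmax_pos_eq d_def)
  qed
  then show ?thesis using Lmax_positive by (auto simp: maximal_positive_def)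
qed

lemma Lmax_maximal_negative: "maximal_negative J Lmax_neg"
proof -
  have "L' \<subseteq> Lmax_neg" if L': "negative_subspace J L'" "Lmax_neg \<subseteq> L'" for L'
  proof
    fix f assume f: "f \<in> L'"
    have csub: "closed_csubspace L'" using L' by (simp add: negative_subspace_def)
    define d where "d = f - (Pm f + T (Pm f))"
    have "d \<in> L'" unfolding d_def
      using L'(2) f by (intro closed_csubspaceD(3)[OF csub]) auto
    moreover have "d = Pp f - T (Pm f)" unfolding d_def using P_sum[of f] by (simp add: algebra_simps)
    then have "J d = d" using J_T_minus[of "Pm f"] by (simp add: J_simps)
    ultimately have "d = 0"
      using L'(1) inner_ge_zero[of d]
      by (auto simp: negative_subspace_def indef_def Re_cinner simp del: inner_ge_zero)
    then show "f \<in> Lmax_neg" by (simp add: Lmax_neg_eq d_def)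
  qed
  then show ?thesis using Lmax_negative by (auto simp: maximal_negative_def)
qed

lemma Lpos_subset: "Lpos \<subseteq> Lmax_pos"
proof
  fix f assume f: "f \<in> Lpos"
  have "Pp f + T (Pp f) = f"
    using T_eq_T0[OF dom0I[OF f Lneg_closed(1)]] T0_eq[OF f Lneg_closed(1)] P_sum[of f]
    by (simp add: Pp_simps Pm_simps)
  then show "f \<in> Lmax_pos" by (simp add: Lmax_pos_eq)
qed

lemma Lneg_subset: "Lneg \<subseteq> Lmax_neg"
proof
  fix f assume f: "f \<in> Lneg"
  have "Pm f + T (Pm f) = f"
    using T_eq_T0[OF dom0I[OF Lpos_closed(1) f]] T0_eq[OF Lpos_closed(1) f] P_sum[of f]
    by (simp add: Pp_simps Pm_simps add.commute)
  then show "f \<in> Lmax_neg" by (simp add: Lmax_neg_eq)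
qed

theorem Lmax_extension: "(Lmax_pos, Lmax_neg) \<in> dual_maximal_extensions J Lpos Lneg"
proof -
  have "cinner (J f) g = 0" if fg: "f \<in> Lmax_pos" "g \<in> Lmax_neg" for f g
  proof (rule complex_eqI)
    have re: "inner (J f) h = 0" if "h \<in> Lmax_neg" for h
      using fg(1) that indef_pos_neg by blast
    show "Re (cinner (J f) g) = Re 0" using re fg by (simp add: Re_cinner)
    show "Im (cinner (J f) g) = Im 0"
      using re[OF closed_csubspaceD(5)[OF Lmax_subspace(2) fg(2)]] by (simp add: Im_cinner)
  qed
  then show ?thesis
    using Lmax_positive Lmax_negative Lmax_maximal_positive Lmax_maximal_negative Lpos_subset Lneg_subset
    by (simp add: dual_maximal_extensions_def dual_maximal_definite_def dual_definite_def indef_def)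
qed

section \<open>The energy space of the maximal subspaces\<close>

definition energy :: "'a \<Rightarrow> 'a \<Rightarrow> real" where
  "energy x y = inner x y - inner (T x) (T y)"

lemma energy_nonneg: "0 \<le> energy x x"
  using T_contraction[of x] by (simp add: energy_def norm_le)

lemma energy_simps:
  "energy (x - y) z = energy x z - energy y z" "energy z (x - y) = energy z x - energy z y"
  "energy x x = (norm x)^2 - (norm (T x))^2" "energy (mult_i x) (mult_i y) = energy x y"
  by (simp_all add: energy_def T_simps inner_diff power2_norm_eq_inner)

lemma energy_commute: "energy x y = energy y x"
  by (simp add: energy_def inner_commute)

lemma energy_Cauchy_Schwarz: "\<bar>energy x y\<bar> \<le> sqrt (energy x x) * sqrt (energy y y)"
proof -
  have e: "inner (x - T (T x)) y = energy x y" for x y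
    by (simp add: energy_def inner_diff_left T_sym)
  have "(inner (x - T (T x)) y)^2 \<le> inner (x - T (T x)) x * inner (y - T (T y)) y"
    using selfadjoint_diff[OF selfadjoint_id selfadjoint_sandwich[OF T_selfadjoint selfadjoint_id]]
    by (rule positive_Cauchy_Schwarz) (simp add: e energy_nonneg)
  then have "(energy x y)^2 \<le> energy x x * energy y y" by (simp add: e)
  then have "sqrt ((energy x y)^2) \<le> sqrt (energy x x * energy y y)" by (rule real_sqrt_le_mono)
  then show ?thesis by (simp add: real_sqrt_mult)
qed

lemma alg_sum_Lmax: "alg_sum Lmax_pos Lmax_neg = range (\<lambda>x. x + T x)"
proof (intro set_eqI iffI)
  fix h assume "h \<in> alg_sum Lmax_pos Lmax_neg"
  then obtain x y where "h = (x + T x) + (y + T y)" by (auto simp: alg_sum_def)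
  then have "h = (x + y) + T (x + y)" by (simp add: T_simps)
  then show "h \<in> range (\<lambda>x. x + T x)" by (rule range_eqI)
next
  fix h assume "h \<in> range (\<lambda>x. x + T x)"
  then obtain x where "h = x + T x" by blast
  then have "h = (Pp x + T (Pp x)) + (Pm x + T (Pm x))"
    using P_sum[of x] T_simps(2)[of "Pp x" "Pm x"] by (simp add: algebra_simps)
  moreover have "Pp x + T (Pp x) \<in> Lmax_pos" "Pm x + T (Pm x) \<in> Lmax_neg" by simp_all
  ultimately show "h \<in> alg_sum Lmax_pos Lmax_neg" unfolding alg_sum_def by blast
qed

lemma comp_plus_eq: "comp_plus Lmax_pos Lmax_neg (x + T x) = Pp x + T (Pp x)"
  unfolding comp_plus_def
proof (rule the_equality)
  have "x + T x - (Pp x + T (Pp x)) = Pm x + T (Pm x)"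
    using P_sum[of x] T_simps(2)[of "Pp x" "Pm x"] by (simp add: algebra_simps)
  then show "Pp x + T (Pp x) \<in> Lmax_pos \<and> x + T x - (Pp x + T (Pp x)) \<in> Lmax_neg" by auto
  fix u assume u: "u \<in> Lmax_pos \<and> x + T x - u \<in> Lmax_neg"
  from u obtain y where y: "J y = y" "u = y + T y" by auto
  from u obtain z where z: "J z = - z" "x + T x - u = z + T z" by auto
  have "x + T x = (y + T y) + (z + T z)" unfolding z(2)[symmetric] y(2) by simp
  moreover have "(x - (y + z)) + T (x - (y + z)) = (x + T x) - ((y + T y) + (z + T z))" by (simp add: T_simps)
  ultimately have "(x - (y + z)) + T (x - (y + z)) = 0" by (simp only: diff_self)
  from T_plus_injective[OF this] have "x = y + z" by simp
  then have "Pp x = y" using y(1) z(1) by (simp add: Pp_simps P_of_plus P_of_minus)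
  then show "u = Pp x + T (Pp x)" using y by simp
qed

lemma comp_minus_eq: "comp_minus Lmax_pos Lmax_neg (x + T x) = Pm x + T (Pm x)"
  unfolding comp_minus_def comp_plus_eq
  using P_sum[of x] T_simps(2)[of "Pp x" "Pm x"] by (simp add: algebra_simps)

abbreviation "G \<equiv> G_inner J Lmax_pos Lmax_neg"

text \<open>On the positive part \<open>J (1 + T) = 1 - T\<close> and on the negative part \<open>J (1 + T) = - (1 - T)\<close>; so both
  terms of the inner product contribute the form of \<open>1 - T\<^sup>2\<close>, whose cross terms vanish because it
  commutes with \<open>J\<close>.\<close>

lemma G_eq: "G (x + T x) (y + T y) = Complex (energy x y) (energy x (mult_i y))"
proof -
  have re: "inner (J (Pp x + T (Pp x))) (Pp y + T (Pp y)) - inner (J (Pm x + T (Pm x))) (Pm y + T (Pm y))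
      = energy x y" for y
  proof -
    have o: "inner (Pp u) (Pm v) = 0" "inner (Pm v) (Pp u) = 0"
      "inner (T (Pp u)) (T (Pm v)) = 0" "inner (T (Pm v)) (T (Pp u)) = 0" for u v
      using plus_minus_orthogonal[of "Pp u" "Pm v"] plus_minus_orthogonal[of "T (Pm v)" "T (Pp u)"]
        J_T_plus[of "Pp u"] J_T_minus[of "Pm v"] by (simp_all add: inner_commute)
    have "energy x y = energy (Pp x + Pm x) (Pp y + Pm y)" by (simp add: P_sum)
    also have "\<dots> = energy (Pp x) (Pp y) + energy (Pm x) (Pm y)"
      by (simp add: energy_def T_simps inner_add o)
    finally show ?thesis by (simp add: indef_pos indef_neg energy_def del: minus_diff_eq)
  qed
  show ?thesis
  proof (rule complex_eqI)
    show "Re (G (x + T x) (y + T y)) = Re (Complex (energy x y) (energy x (mult_i y)))"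
      using re[of y] by (simp add: G_inner_def comp_plus_eq comp_minus_eq indef_def Re_cinner)
    show "Im (G (x + T x) (y + T y)) = Im (Complex (energy x y) (energy x (mult_i y)))"
      using re[of "mult_i y"]
      by (simp add: G_inner_def comp_plus_eq comp_minus_eq indef_def Im_cinner Pp_simps Pm_simps T_simps)
  qed
qed

lemma G_norm: "ip_norm G (x + T x) = sqrt (energy x x)"
  by (simp add: ip_norm_def G_eq)

lemma T_plus_diff: "(x + T x) - (y + T y) = (x - y) + T (x - y)"
  by (simp add: T_simps)

lemma semi_inner_G: "semi_inner_on (range (\<lambda>x. x + T x)) G"
proof
  fix f g h assume "f \<in> range (\<lambda>x. x + T x)" "g \<in> range (\<lambda>x. x + T x)" "h \<in> range (\<lambda>x. x + T x)"
  then obtain x y z where [simp]: "f = x + T x" "g = y + T y" "h = z + T z" by blast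
  show "G (f - g) h = G f h - G g h" "G h (f - g) = G h f - G h g"
    by (simp_all add: T_plus_diff G_eq energy_simps complex_eq_iff del: add_diff_eq diff_diff_eq)
next
  fix f g assume "f \<in> range (\<lambda>x. x + T x)" "g \<in> range (\<lambda>x. x + T x)"
  then obtain x y where fg [simp]: "f = x + T x" "g = y + T y" by blast
  show "f - g \<in> range (\<lambda>x. x + T x)" unfolding fg T_plus_diff by blast
  have "energy (x - y) (x - y) = energy x x - 2 * energy x y + energy y y"
    using energy_commute[of x y] by (simp add: energy_simps(1,2))
  also have "\<dots> \<le> (sqrt (energy x x) + sqrt (energy y y))^2"
    using energy_Cauchy_Schwarz[of x y] energy_nonneg[of x] energy_nonneg[of y]
    by (simp add: power2_sum abs_le_iff)
  finally show "ip_norm G (f - g) \<le> ip_norm G f + ip_norm G g"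
    unfolding fg T_plus_diff G_norm using energy_nonneg by (intro real_le_lsqrt) auto
  show "cmod (G f g) \<le> 2 * ip_norm G f * ip_norm G g"
    using energy_Cauchy_Schwarz[of x y] energy_Cauchy_Schwarz[of x "mult_i y"]
      cmod_le[of "G f g"] by (simp add: G_eq G_norm energy_simps(4))
next
  fix f assume "f \<in> range (\<lambda>x. x + T x)"
  then obtain x where [simp]: "f = x + T x" by blast
  show "Im (G f f) = 0" by (simp add: G_eq energy_def T_simps)
  show "0 \<le> Re (G f f)" by (simp add: G_eq energy_nonneg)
qed

theorem dense_in_HG_iff:
  "dense_in_HG J Lmax_pos Lmax_neg (alg_sum Lpos Lneg) \<longleftrightarrow>
    (\<forall>x. \<forall>e>0. \<exists>y\<in>dom0. energy (x - y) (x - y) < e)"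
proof -
  have "dense_in_HG J Lmax_pos Lmax_neg (alg_sum Lpos Lneg) \<longleftrightarrow>
      (\<forall>s\<in>range (\<lambda>x. x + T x). \<forall>e>0. \<exists>f\<in>(\<lambda>y. y + T y) ` dom0. ip_norm G (s - f) < e)"
    unfolding dense_in_HG_def alg_sum_Lmax alg_sum_eq
    by (intro semi_inner_on.dense_in_completion_iff semi_inner_G) auto
  also have "\<dots> \<longleftrightarrow> (\<forall>x. \<forall>e>0. \<exists>y\<in>dom0. sqrt (energy (x - y) (x - y)) < e)"
    by (simp only: ball_simps bex_simps T_plus_diff G_norm ball_UNIV)
  also have "\<dots> \<longleftrightarrow> (\<forall>x. \<forall>e>0. \<exists>y\<in>dom0. energy (x - y) (x - y) < e)"
  proof (intro iffI allI impI)
    fix x and e :: real assume *: "\<forall>x. \<forall>e>0. \<exists>y\<in>dom0. sqrt (energy (x - y) (x - y)) < e" and "e > 0"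
    then obtain y where "y \<in> dom0" "sqrt (energy (x - y) (x - y)) < sqrt e" by (meson real_sqrt_gt_zero)
    then show "\<exists>y\<in>dom0. energy (x - y) (x - y) < e" by auto
  next
    fix x and e :: real assume *: "\<forall>x. \<forall>e>0. \<exists>y\<in>dom0. energy (x - y) (x - y) < e" and e: "e > 0"
    then obtain y where "y \<in> dom0" "energy (x - y) (x - y) < e^2" by (meson zero_less_power)
    then show "\<exists>y\<in>dom0. sqrt (energy (x - y) (x - y)) < e"
      using e by (intro bexI[of _ y]) (auto intro: real_sqrt_less_mono[THEN less_le_trans])
  qed
  finally show ?thesis .
qed

text \<open>The minimising \<open>u\<close> is \<open>(z + T z) / 2\<close>: the form of \<open>(1 - T\<^sup>2) / 2\<close> is the parallel sum of the forms of
  \<open>1 + T\<close> and \<open>1 - T\<close>.\<close>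

lemma energy_parallel_sum:
  "energy z z + (norm (2 *\<^sub>R u - (z + T z)))^2
    = 2 * (inner ((z - u) + T (z - u)) (z - u) + inner (u - T u) u)"
  using T_sym[of z u] T_sym[of u z] unfolding energy_simps(3) power2_norm_eq_inner
  by (simp add: T_simps inner_add inner_diff algebra_simps inner_commute)

end

section \<open>Extensions built from a hypermaximal neutral subspace\<close>

text \<open>The maximal subspaces are the graphs of \<open>T\<close> over the positive and over the negative part.\<close>

lemma Lmax_determines_extension:
  assumes "anticommuting_extension J Lpos Lneg T" "anticommuting_extension J Lpos Lneg T'"
    and pos: "(\<lambda>x. x + T x) ` {x. J x = x} = (\<lambda>x. x + T' x) ` {x. J x = x}"
    and neg: "(\<lambda>x. x + T x) ` {x. J x = - x} = (\<lambda>x. x + T' x) ` {x. J x = - x}"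
  shows "T = T'"
proof
  fix x
  interpret A: anticommuting_extension J Lpos Lneg T by (rule assms)
  interpret B: anticommuting_extension J Lpos Lneg T' by (rule assms)
  have p: "T (A.Pp x) = T' (A.Pp x)"
  proof -
    have "A.Pp x + T (A.Pp x) \<in> B.Lmax_pos" unfolding pos[symmetric] by simp
    then show ?thesis
      unfolding B.Lmax_pos_eq using A.J_T_plus[of "A.Pp x"] by (simp add: A.Pp_simps A.P_of_plus A.P_of_minus)
  qed
  have m: "T (A.Pm x) = T' (A.Pm x)"
  proof -
    have "A.Pm x + T (A.Pm x) \<in> B.Lmax_neg" unfolding neg[symmetric] by simp
    then show ?thesis
      unfolding B.Lmax_neg_eq using A.J_T_minus[of "A.Pm x"] by (simp add: A.Pm_simps A.P_of_plus A.P_of_minus)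
  qed
  show "T x = T' x"
    using p m A.T_simps(2)[of "A.Pp x" "A.Pm x"] B.T_simps(2)[of "A.Pp x" "A.Pm x"] by (simp add: A.P_sum)
qed

text \<open>\<open>P\<close> is the orthogonal projection onto \<open>M1\<close>, and \<open>R\<close> a square root of \<open>TM - Tmu\<close> commuting with \<open>J\<close>.\<close>

locale hypermaximal_pair = dual_definite_pair J Lpos Lneg
  for J :: "'a::chilbert_space \<Rightarrow> 'a" and Lpos Lneg +
  fixes M1 :: "'a set" and P R :: "'a \<Rightarrow> 'a"
  assumes dense: "closure (alg_sum Lpos Lneg) = UNIV"
    and hypermaximal: "hypermaximal_neutral J (M_space J Lpos Lneg) M1"
    and P_selfadjoint: "selfadjoint P" and P_mem: "P x \<in> M1" and P_id: "m \<in> M1 \<Longrightarrow> P m = m"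
    and R_selfadjoint: "selfadjoint R" and R_R: "R (R x) = TM x - Tmu x" and R_J: "R (J x) = J (R x)"
begin

abbreviation "M \<equiv> M_space J Lpos Lneg"

lemmas R_simps = selfadjointD(2,4-8)[OF R_selfadjoint]
lemmas R_sym = selfadjointD(3)[OF R_selfadjoint]
lemmas P_sym = selfadjointD(3)[OF P_selfadjoint]

lemma M_eq: "M = closure (range R)"
  using closure_range_of_square[OF R_selfadjoint] by (simp add: M_space_def R_R)

lemma R_mem: "R x \<in> M"
  unfolding M_eq by (rule subsetD[OF closure_subset rangeI])

lemma M1_subspace: "closed_csubspace M1"
  using hypermaximal by (simp add: hypermaximal_neutral_def)

lemmas M1_closed = closed_csubspaceD[OF M1_subspace]

lemma M_decomposition: "M = {m + J n | m n. m \<in> M1 \<and> n \<in> M1}"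
  using hypermaximal by (auto simp: hypermaximal_neutral_def alg_sum_def)

lemma M1_orthogonal:
  assumes "m \<in> M1" "n \<in> M1"
  shows "inner m (J n) = 0"
proof -
  have "cinner m (J n) = 0" using assms hypermaximal by (simp add: hypermaximal_neutral_def)
  then show ?thesis unfolding Re_cinner[symmetric] by simp
qed

lemma P_J_M1: assumes "m \<in> M1" shows "P (J m) = 0"
proof -
  have "inner (P (J m)) (P (J m)) = inner (P (J m)) (J m)" by (simp add: P_sym[of "J m"] P_id P_mem inner_commute)
  also have "\<dots> = 0" by (intro M1_orthogonal P_mem assms)
  finally show ?thesis by simp
qed

lemma M_closed:
  assumes "z \<in> M"
  shows "J z \<in> M" "r *\<^sub>R z \<in> M" "mult_i z \<in> M" "w \<in> M \<Longrightarrow> z + w \<in> M" "w \<in> M \<Longrightarrow> z - w \<in> M"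
proof -
  obtain m n where z: "z = m + J n" "m \<in> M1" "n \<in> M1" using assms unfolding M_decomposition by blast
  show "J z \<in> M" unfolding M_decomposition using z by (auto simp: J_simps add.commute)
  show "r *\<^sub>R z \<in> M" for r
    unfolding M_decomposition using z M1_closed(4)[OF z(2), of r] M1_closed(4)[OF z(3), of r]
    by (auto simp: J_simps(6)[symmetric] scaleR_add_right)
  show "mult_i z \<in> M"
    unfolding M_decomposition using z M1_closed(5)[OF z(2)] M1_closed(5)[OF z(3)]
    by (auto simp: J_simps(1)[symmetric])
  show sum: "z + w \<in> M" if "w \<in> M" for w
  proof -
    obtain m' n' where w: "w = m' + J n'" "m' \<in> M1" "n' \<in> M1" using \<open>w \<in> M\<close> unfolding M_decomposition by blast
    have "z + w = (m + m') + J (n + n')" by (simp add: z w J_simps)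
    then show ?thesis unfolding M_decomposition using z w M1_closed(2) by blast
  qed
  show "z - w \<in> M" if "w \<in> M" for w
  proof -
    obtain m' n' where w: "w = m' + J n'" "m' \<in> M1" "n' \<in> M1" using \<open>w \<in> M\<close> unfolding M_decomposition by blast
    have "z - w = (m - m') + J (n - n')" by (simp add: z w J_simps)
    then show ?thesis unfolding M_decomposition using z w M1_closed(3) by blast
  qed
qed

text \<open>\<open>J P J\<close> is the projection onto \<open>J M1\<close>, so on \<open>M\<close> this is \<open>1\<close> on \<open>M1\<close> and \<open>-1\<close> on \<open>J M1\<close>.\<close>

definition sgn_M :: "'a \<Rightarrow> 'a" where
  "sgn_M x = P x - J (P (J x))"

lemma sgn_M_selfadjoint: "selfadjoint sgn_M"
  unfolding sgn_M_def[abs_def]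
  by (rule selfadjoint_diff[OF P_selfadjoint selfadjoint_sandwich[OF J_selfadjoint P_selfadjoint]])

lemmas sgn_M_simps = selfadjointD(2,4-8)[OF sgn_M_selfadjoint]
lemmas sgn_M_sym = selfadjointD(3)[OF sgn_M_selfadjoint]

lemma sgn_M_J: "sgn_M (J x) = - J (sgn_M x)"
  by (simp add: sgn_M_def J_simps)

lemma sgn_M_M1: "m \<in> M1 \<Longrightarrow> sgn_M m = m"
  by (simp add: sgn_M_def P_id P_J_M1 J_simps)

lemma sgn_M_M: assumes "z \<in> M" shows "sgn_M z \<in> M" "sgn_M (sgn_M z) = z"
proof -
  obtain m n where z: "z = m + J n" "m \<in> M1" "n \<in> M1" using assms unfolding M_decomposition by blast
  have "sgn_M z = m + J (- n)" by (simp add: z sgn_M_simps sgn_M_J sgn_M_M1 J_simps)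
  moreover have "- n \<in> M1" using M1_closed(4)[OF z(3), of "-1"] by simp
  ultimately show "sgn_M z \<in> M" unfolding M_decomposition using z(2) by blast
  show "sgn_M (sgn_M z) = z" by (simp add: z sgn_M_simps sgn_M_J sgn_M_M1 J_simps)
qed

text \<open>On \<open>M\<close>, both \<open>sgn_M\<close> and \<open>\<i> J sgn_M\<close> are symmetries, and they anticommute with each other and with \<open>J\<close>.
  Mixing them keeps the square scalar, which yields a whole circle of symmetries.\<close>

definition rot_sgn :: "real \<Rightarrow> real \<Rightarrow> 'a \<Rightarrow> 'a" where
  "rot_sgn a b x = a *\<^sub>R sgn_M x + b *\<^sub>R mult_i (J (sgn_M x))"

lemma rot_sgn_selfadjoint: "selfadjoint (rot_sgn a b)"
proof -
  have "selfadjoint (\<lambda>x. mult_i (J (sgn_M x)))"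
    unfolding selfadjoint_iff
  proof (intro conjI allI)
    show "bounded_linear (\<lambda>x. mult_i (J (sgn_M x)))"
      using bounded_linear_compose[OF bounded_linear_mult_i bounded_linear_compose[OF
          selfadjointD(1)[OF J_selfadjoint] selfadjointD(1)[OF sgn_M_selfadjoint]]] .
    show "mult_i (J (sgn_M (mult_i x))) = mult_i (mult_i (J (sgn_M x)))" for x
      by (simp add: sgn_M_simps J_simps)
    show "inner (mult_i (J (sgn_M x))) y = inner x (mult_i (J (sgn_M y)))" for x y
      by (simp add: inner_mult_i_left J_sym sgn_M_sym sgn_M_J sgn_M_simps J_simps)
  qed
  from selfadjoint_add[OF selfadjoint_scaleR[OF sgn_M_selfadjoint] selfadjoint_scaleR[OF this]]
  show ?thesis unfolding rot_sgn_def[abs_def] .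
qed

lemmas rot_sgn_simps = selfadjointD(2,4-8)[OF rot_sgn_selfadjoint]
lemmas rot_sgn_sym = selfadjointD(3)[OF rot_sgn_selfadjoint]

lemma rot_sgn_J: "rot_sgn a b (J x) = - J (rot_sgn a b x)"
  by (simp add: rot_sgn_def sgn_M_J J_simps)

lemma rot_sgn_M:
  assumes "z \<in> M"
  shows "rot_sgn a b z \<in> M" "rot_sgn a b (rot_sgn a b z) = (a^2 + b^2) *\<^sub>R z"
proof -
  show "rot_sgn a b z \<in> M" unfolding rot_sgn_def by (intro M_closed sgn_M_M assms)
  have XZ: "sgn_M (rot_sgn a b z) = a *\<^sub>R z - b *\<^sub>R mult_i (J z)"
    by (simp add: rot_sgn_def sgn_M_simps sgn_M_J sgn_M_M assms)
  then show "rot_sgn a b (rot_sgn a b z) = (a^2 + b^2) *\<^sub>R z"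
    unfolding rot_sgn_def[of a b "rot_sgn a b z"] XZ
    by (simp add: J_simps algebra_simps power2_eq_square)
qed

lemma rot_sgn_norm: assumes "z \<in> M" shows "norm (rot_sgn a b z) = sqrt (a^2 + b^2) * norm z"
proof -
  have "(norm (rot_sgn a b z))^2 = (a^2 + b^2) * (norm z)^2"
    by (simp add: power2_norm_eq_inner rot_sgn_sym rot_sgn_M assms)
  then show ?thesis
    by (metis norm_ge_zero real_sqrt_mult real_sqrt_unique)
qed

lemma rot_sgn_form_bound: assumes "z \<in> M" shows "\<bar>inner (rot_sgn a b z) z\<bar> \<le> sqrt (a^2 + b^2) * (norm z)^2"
  using Cauchy_Schwarz_ineq2[of "rot_sgn a b z" z] by (simp add: rot_sgn_norm assms power2_eq_square)

definition T_rot :: "real \<Rightarrow> real \<Rightarrow> 'a \<Rightarrow> 'a" where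
  "T_rot a b x = (1/2) *\<^sub>R (Tmu x + TM x) + (1/2) *\<^sub>R R (rot_sgn a b (R x))"

lemma T_rot_selfadjoint: "selfadjoint (T_rot a b)"
  unfolding T_rot_def[abs_def]
  by (rule selfadjoint_add[OF
        selfadjoint_scaleR[OF selfadjoint_add[OF extensionsD(1)[OF T_mu_extension] extensionsD(1)[OF T_M_extension]]]
        selfadjoint_scaleR[OF selfadjoint_sandwich[OF R_selfadjoint rot_sgn_selfadjoint]]])

lemma T_rot_form:
  shows T_rot_lower_form: "inner (x + T_rot a b x) x
      = inner (x + Tmu x) x + ((norm (R x))^2 + inner (rot_sgn a b (R x)) (R x)) / 2"
    and T_rot_upper_form: "inner (x - T_rot a b x) x
      = inner (x - TM x) x + ((norm (R x))^2 - inner (rot_sgn a b (R x)) (R x)) / 2"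
proof -
  have "inner (T_rot a b x) x = (inner (Tmu x) x + inner (TM x) x + inner (rot_sgn a b (R x)) (R x)) / 2"
    by (simp add: T_rot_def inner_add_left R_sym add_divide_distrib)
  moreover have "inner (TM x) x - inner (Tmu x) x = (norm (R x))^2"
    unfolding inner_diff_left[symmetric] R_R[symmetric] by (simp add: R_sym power2_norm_eq_inner)
  ultimately show "inner (x + T_rot a b x) x
      = inner (x + Tmu x) x + ((norm (R x))^2 + inner (rot_sgn a b (R x)) (R x)) / 2"
    "inner (x - T_rot a b x) x = inner (x - TM x) x + ((norm (R x))^2 - inner (rot_sgn a b (R x)) (R x)) / 2"
    unfolding inner_add_left inner_diff_left by argo+
qed

lemma R_dom0: assumes "y \<in> dom0" shows "R y = 0"
proof -
  have "R (R y) = 0"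
    using assms extensionsD(3)[OF T_M_extension] extensionsD(3)[OF T_mu_extension] by (simp add: R_R)
  then show ?thesis using R_sym[of "R y" y] by simp
qed

lemma T_rot_anticommuting_extension:
  assumes ab: "a^2 + b^2 \<le> 1"
  shows "anticommuting_extension J Lpos Lneg (T_rot a b)"
proof unfold_locales
  show "closure (alg_sum Lpos Lneg) = UNIV" by (rule dense)
  have bd: "\<bar>inner (rot_sgn a b (R x)) (R x)\<bar> \<le> (norm (R x))^2" for x
    using rot_sgn_form_bound[OF R_mem, of a b x] mult_right_mono[of "sqrt (a^2 + b^2)" 1 "(norm (R x))^2"] ab by simp
  have "inner (Tmu x) x \<le> inner (T_rot a b x) x" for x
    using T_rot_lower_form[of x a b] bd[of x] unfolding inner_add_left abs_le_iff by argo
  moreover have "inner (T_rot a b x) x \<le> inner (TM x) x" for x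
    using T_rot_upper_form[of x a b] bd[of x] unfolding inner_diff_left abs_le_iff by argo
  ultimately show "T_rot a b \<in> extensions"
    unfolding extensions_eq by (simp add: operator_interval_def op_le_iff T_rot_selfadjoint)
  show "J (T_rot a b x) = - T_rot a b (J x)" for x
  proof -
    have "R (rot_sgn a b (R (J x))) = - J (R (rot_sgn a b (R x)))" by (simp add: R_J rot_sgn_J R_simps)
    moreover have "TM (J x) = - J (Tmu x)" "Tmu (J x) = - J (TM x)"
      by (simp_all add: T_M_eq reflect_def J_simps)
    ultimately show ?thesis by (simp add: T_rot_def J_simps algebra_simps)
  qed
qed

text \<open>Choose \<open>u\<close> with \<open>R u\<close> close to \<open>(1 + Z) R x / 2\<close>, where \<open>Z = rot_sgn a b\<close>, and then \<open>y1\<close>, \<open>y2\<close> in \<open>dom0\<close>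
  that make the forms of \<open>1 + Tmu\<close> at \<open>x - u - y1\<close> and of \<open>1 - TM\<close> at \<open>u - y2\<close> small. Splitting
  \<open>x - (y1 + y2)\<close> into these two vectors bounds its energy.\<close>

theorem dense_if_unitary:
  assumes ab: "a^2 + b^2 = 1"
  shows "dense_in_HG J ((\<lambda>x. x + T_rot a b x) ` {x. J x = x}) ((\<lambda>x. x + T_rot a b x) ` {x. J x = - x})
    (alg_sum Lpos Lneg)"
proof -
  interpret E: anticommuting_extension J Lpos Lneg "T_rot a b"
    using ab by (intro T_rot_anticommuting_extension) simp
  show ?thesis
    unfolding E.dense_in_HG_iff
  proof (intro allI impI)
    fix x and e :: real assume e: "e > 0"
    define v0 where "v0 = (1/2) *\<^sub>R (R x + rot_sgn a b (R x))"
    have v0: "v0 \<in> M" unfolding v0_def by (intro M_closed rot_sgn_M R_mem)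
    have ZZ: "rot_sgn a b (rot_sgn a b (R x)) = R x" using rot_sgn_M(2)[OF R_mem, of a b x] ab by simp
    have "sqrt (e / 8) > 0" using e by simp
    then obtain u where u: "norm (R u - v0) < sqrt (e / 8)"
      using v0 unfolding M_eq closure_approachable dist_norm by blast
    define k where "k = R u - v0"
    have kM: "k \<in> M" unfolding k_def by (intro M_closed R_mem v0)
    have k: "(norm k)^2 < e / 8"
      using power_strict_mono[OF u norm_ge_zero, of 2] e by (simp add: k_def)
    have Zk: "\<bar>inner (rot_sgn a b k) k\<bar> \<le> (norm k)^2" using rot_sgn_form_bound[OF kM, of a b] ab by simp
    \<comment> \<open>\<open>1 + rot_sgn\<close> vanishes at \<open>R x - v0\<close> and \<open>1 - rot_sgn\<close> vanishes at \<open>v0\<close>, so only \<open>k\<close> contributes.\<close>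
    have plus: "(norm (R (x - u)))^2 + inner (rot_sgn a b (R (x - u))) (R (x - u)) \<le> 2 * (norm k)^2"
    proof -
      have "selfadjoint (\<lambda>p. p + rot_sgn a b p)" by (intro selfadjoint_add selfadjoint_id rot_sgn_selfadjoint)
      moreover have "(v0 - R x) + rot_sgn a b (v0 - R x) = 0"
        by (simp add: v0_def rot_sgn_simps ZZ algebra_simps flip: scaleR_add_left)
      ultimately have "inner (- k - (v0 - R x) + rot_sgn a b (- k - (v0 - R x))) (- k - (v0 - R x))
          = inner (- k + rot_sgn a b (- k)) (- k)" by (rule form_shift)
      moreover have "- k - (v0 - R x) = R (x - u)" by (simp add: k_def R_simps)
      ultimately show ?thesis using Zk by (simp add: inner_add_left inner_diff_left power2_norm_eq_inner rot_sgn_simps)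
    qed
    have minus: "(norm (R u))^2 - inner (rot_sgn a b (R u)) (R u) \<le> 2 * (norm k)^2"
    proof -
      have "selfadjoint (\<lambda>p. p - rot_sgn a b p)" by (intro selfadjoint_diff selfadjoint_id rot_sgn_selfadjoint)
      moreover have "- v0 - rot_sgn a b (- v0) = 0"
        by (simp add: v0_def rot_sgn_simps ZZ algebra_simps)
      ultimately have "inner (k - (- v0) - rot_sgn a b (k - (- v0))) (k - (- v0)) = inner (k - rot_sgn a b k) k"
        by (rule form_shift)
      moreover have "k - (- v0) = R u" by (simp add: k_def)
      ultimately show ?thesis using Zk by (simp add: inner_diff_left power2_norm_eq_inner)
    qed
    have "e / 8 > 0" using e by simp
    then obtain y1 y2 where
      y1: "y1 \<in> dom0" "inner ((x - u - y1) + Tmu (x - u - y1)) (x - u - y1) < e / 8" and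
      y2: "y2 \<in> dom0" "inner ((u - y2) - TM (u - y2)) (u - y2) < e / 8"
      using T_mu_infimum T_M_infimum by meson
    define y where "y = y1 + y2"
    have "y \<in> dom0" unfolding y_def using dom0_add[OF y1(1) y2(1)] by blast
    have z: "(x - y) - (u - y2) = x - u - y1" by (simp add: y_def)
    have R_eq: "R (x - u - y1) = R (x - u)" "R (u - y2) = R u"
      using R_dom0 y1(1) y2(1) by (simp_all add: R_simps)
    have "inner ((x - u - y1) + T_rot a b (x - u - y1)) (x - u - y1)
        + inner ((u - y2) - T_rot a b (u - y2)) (u - y2) < e / 8 + (norm k)^2 + (e / 8 + (norm k)^2)"
      unfolding T_rot_lower_form T_rot_upper_form R_eq using y1(2) y2(2) plus minus by argo
    then have "E.energy (x - y) (x - y) < 2 * (e / 8 + (norm k)^2 + (e / 8 + (norm k)^2))"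
      using E.energy_parallel_sum[of "x - y" "u - y2", unfolded z]
        zero_le_power2[of "norm (2 *\<^sub>R (u - y2) - (x - y + T_rot a b (x - y)))"] by argo
    also have "\<dots> \<le> e" using k by simp
    finally show "\<exists>y\<in>dom0. E.energy (x - y) (x - y) < e" using \<open>y \<in> dom0\<close> by blast
  qed
qed

text \<open>For every splitting of \<open>x - y\<close> into \<open>p + u\<close>, the forms of \<open>1 + T\<close> at \<open>p\<close> and of \<open>1 - T\<close> at \<open>u\<close> dominate
  positive multiples of \<open>\<parallel>R p\<parallel>\<^sup>2\<close> and \<open>\<parallel>R u\<parallel>\<^sup>2\<close>, while \<open>R p + R u = R x\<close> for all \<open>y \<in> dom0\<close>.\<close>

theorem not_dense_if_strict:
  assumes ab: "a^2 + b^2 < 1" and ne: "Tmu \<noteq> TM"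
  shows "\<not> dense_in_HG J ((\<lambda>x. x + T_rot a b x) ` {x. J x = x}) ((\<lambda>x. x + T_rot a b x) ` {x. J x = - x})
    (alg_sum Lpos Lneg)"
proof -
  interpret E: anticommuting_extension J Lpos Lneg "T_rot a b"
    using ab by (intro T_rot_anticommuting_extension) simp
  define s where "s = 1 - sqrt (a^2 + b^2)"
  have s: "s > 0" using ab by (simp add: s_def)
  obtain x where "Tmu x \<noteq> TM x" using ne by blast
  then have "R x \<noteq> 0" using R_R[of x] R_simps(5) by auto
  then have e: "0 < s / 2 * (norm (R x))^2" using s by simp
  have lower: "s * (norm (R w))^2 \<le> (norm (R w))^2 + inner (rot_sgn a b (R w)) (R w)"
    and upper: "s * (norm (R w))^2 \<le> (norm (R w))^2 - inner (rot_sgn a b (R w)) (R w)" for w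
    using rot_sgn_form_bound[OF R_mem, of a b w] by (simp_all add: s_def algebra_simps abs_le_iff)
  have "s / 2 * (norm (R x))^2 \<le> E.energy (x - y) (x - y)" if y: "y \<in> dom0" for y
  proof -
    define z u where "z = x - y" and "u = (1/2) *\<^sub>R (z + T_rot a b z)"
    have Rz: "R (z - u) + R u = R x" using R_dom0[OF y] by (simp add: z_def R_simps)
    have "(norm (R x))^2 + (norm (R (z - u) - R u))^2 = 2 * ((norm (R (z - u)))^2 + (norm (R u))^2)"
      unfolding Rz[symmetric] by (simp add: power2_norm_eq_inner inner_add inner_diff)
    then have "(norm (R x))^2 \<le> 2 * ((norm (R (z - u)))^2 + (norm (R u))^2)"
      using zero_le_power2[of "norm (R (z - u) - R u)"] by linarith
    from mult_left_mono[OF this, of "s / 2"] s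
    have "s / 2 * (norm (R x))^2 \<le> s * (norm (R (z - u)))^2 + s * (norm (R u))^2"
      by (simp add: algebra_simps)
    also have "\<dots> \<le> 2 * (inner ((z - u) + T_rot a b (z - u)) (z - u) + inner (u - T_rot a b u) u)"
      unfolding T_rot_lower_form T_rot_upper_form
      using lower[of "z - u"] upper[of u] extension_form_nonneg(1)[OF T_mu_extension, of "z - u"]
        extension_form_nonneg(2)[OF T_M_extension, of u] by argo
    also have "\<dots> = E.energy z z"
      using E.energy_parallel_sum[of z u] by (simp add: u_def)
    finally show ?thesis by (simp add: z_def)
  qed
  then have "\<not> (\<exists>y\<in>dom0. E.energy (x - y) (x - y) < s / 2 * (norm (R x))^2)" by (auto simp: not_less)
  then show ?thesis unfolding E.dense_in_HG_iff using e by blast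
qed

text \<open>The parameter \<open>a\<close> is read off from \<open>(Z m, m) = a \<parallel>m\<parallel>\<^sup>2\<close> for \<open>m \<in> M1\<close>: the other term vanishes as
  \<open>J M1\<close> is orthogonal to \<open>M1\<close>.\<close>

lemma T_rot_injective:
  assumes eq: "T_rot a b = T_rot a' b'" and ne: "Tmu \<noteq> TM"
  shows "a = a'"
proof -
  obtain m where m: "m \<in> M1" "m \<noteq> 0"
  proof (rule ccontr)
    assume "\<not> thesis"
    with that have "M1 \<subseteq> {0}" by blast
    then have "m + J n = 0" if "m \<in> M1" "n \<in> M1" for m n
    proof -
      have "m = 0" "n = 0" using that \<open>M1 \<subseteq> {0}\<close> by blast+
      then show ?thesis by (simp add: J_simps)
    qed
    then have "M \<subseteq> {0}" unfolding M_decomposition by blast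
    then have "R (R x) = 0" for x using R_mem[of x] R_simps(5) by auto
    then have "Tmu = TM" by (simp add: R_R fun_eq_iff)
    with ne show False by simp
  qed
  have mM: "m \<in> M" unfolding M_decomposition using m M1_closed(1) by (force simp: J_simps)
  define D where "D x = rot_sgn a b x - rot_sgn a' b' x" for x
  have D: "selfadjoint D" unfolding D_def by (intro selfadjoint_diff rot_sgn_selfadjoint)
  have "R (rot_sgn a b (R x)) = R (rot_sgn a' b' (R x))" for x
    using fun_cong[OF eq, of x] by (simp add: T_rot_def)
  then have "R (D (R x)) = 0" for x by (simp add: D_def R_simps)
  then have D0: "inner (D (R x)) (R x) = 0" for x using R_sym[of "D (R x)" x] by simp
  obtain w where w: "(\<lambda>n. R (w n)) \<longlonglongrightarrow> m"
  proof -
    have "\<exists>h. (\<forall>n. h n \<in> range R) \<and> h \<longlonglongrightarrow> m"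
      using mM unfolding M_eq closure_sequential .
    then obtain h where h: "\<And>n. h n \<in> range R" "h \<longlonglongrightarrow> m" by blast
    have "\<forall>n. \<exists>x. h n = R x" using h(1) by (simp add: image_iff)
    then obtain w where "h = (\<lambda>n. R (w n))" by metis
    with h(2) show thesis by (intro that[of w]) simp
  qed
  have "(\<lambda>n. inner (D (R (w n))) (R (w n))) \<longlonglongrightarrow> inner (D m) m"
    by (intro tendsto_inner w bounded_linear.tendsto[OF selfadjointD(1)[OF D]])
  then have "inner (D m) m = 0" unfolding D0 by (simp add: LIMSEQ_const_iff)
  moreover have "inner (mult_i (J m)) m = 0"
    unfolding inner_mult_i_left[of "J m" m]
    using M1_orthogonal[OF M1_closed(5)[OF m(1)] m(1)] by (simp add: inner_commute)
  ultimately have "(a - a') * inner m m = 0"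
    using sgn_M_M1[OF m(1)] by (simp add: D_def rot_sgn_def inner_add inner_diff algebra_simps)
  then show ?thesis using m(2) by simp
qed

lemma infinite_extensions:
  assumes ab: "\<And>a. a \<in> A \<Longrightarrow> a^2 + (h a)^2 \<le> 1" and A: "infinite A" and ne: "Tmu \<noteq> TM"
    and Q: "\<And>a. a \<in> A \<Longrightarrow> Q ((\<lambda>x. x + T_rot a (h a) x) ` {x. J x = x}) ((\<lambda>x. x + T_rot a (h a) x) ` {x. J x = - x})"
  shows "infinite {(Lpos', Lneg'). (Lpos', Lneg') \<in> dual_maximal_extensions J Lpos Lneg \<and> Q Lpos' Lneg'}"
proof -
  define F where "F a = ((\<lambda>x. x + T_rot a (h a) x) ` {x. J x = x}, (\<lambda>x. x + T_rot a (h a) x) ` {x. J x = - x})" for a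
  have "inj_on F A"
  proof (rule inj_onI)
    fix a a' assume "a \<in> A" "a' \<in> A" "F a = F a'"
    then have "T_rot a (h a) = T_rot a' (h a')"
      using ab by (intro Lmax_determines_extension[of J Lpos Lneg] T_rot_anticommuting_extension) (auto simp: F_def)
    then show "a = a'" using ne by (rule T_rot_injective)
  qed
  then have "infinite (F ` A)" using A finite_imageD by blast
  moreover have "F ` A \<subseteq> {(Lpos', Lneg'). (Lpos', Lneg') \<in> dual_maximal_extensions J Lpos Lneg \<and> Q Lpos' Lneg'}"
    using anticommuting_extension.Lmax_extension[OF T_rot_anticommuting_extension[OF ab]] Q
    by (auto simp: F_def)
  ultimately show ?thesis using finite_subset by blast
qed

end

theorem corollary4p6:
  fixes J :: "'a::chilbert_space \<Rightarrow> 'a"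
    and Lpos Lneg :: "'a set"
  assumes "fundamental_symmetry J"
    and "dual_definite J Lpos Lneg"
    and "closure (alg_sum Lpos Lneg) = UNIV"
    and "T_mu J Lpos Lneg \<noteq> T_M J Lpos Lneg"
    and "\<exists>M1. hypermaximal_neutral J (M_space J Lpos Lneg) M1"
  shows "infinite {(Lpos', Lneg'). (Lpos', Lneg') \<in> dual_maximal_extensions J Lpos Lneg \<and>
             dense_in_HG J Lpos' Lneg' (alg_sum Lpos Lneg)} \<and>
         infinite {(Lpos', Lneg'). (Lpos', Lneg') \<in> dual_maximal_extensions J Lpos Lneg \<and>
             \<not> dense_in_HG J Lpos' Lneg' (alg_sum Lpos Lneg)}"
proof -
  interpret D: dual_definite_pair J Lpos Lneg by unfold_locales (fact assms)+
  define C where "C x = D.TM x - D.Tmu x" for x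
  obtain M1 where M1: "hypermaximal_neutral J (M_space J Lpos Lneg) M1" using assms by blast
  then have "closed_csubspace M1" by (simp add: hypermaximal_neutral_def)
  note M1_closed = closed_csubspaceD[OF this]
  obtain P where P: "selfadjoint P" "\<And>x. P x \<in> M1" "\<And>x. x \<in> M1 \<Longrightarrow> P x = x"
    using orthogonal_projection_operator[of M1] M1_closed(5-7) by blast
  have C_sa: "selfadjoint C"
    unfolding C_def[abs_def] by (intro selfadjoint_diff D.extensionsD(1) D.T_M_extension D.T_mu_extension)
  have C_pos: "0 \<le> inner (C x) x" for x
    using D.extensions_eq D.T_M_extension by (auto simp: C_def inner_diff_left operator_interval_def op_le_iff)
  have C_bound: "inner (C x) x \<le> 2 * (norm x)^2" for x
    using D.extension_form_nonneg(1)[OF D.T_mu_extension, of x] D.extension_form_nonneg(2)[OF D.T_M_extension, of x]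
    by (simp add: C_def inner_diff_left inner_add_left power2_norm_eq_inner)
  obtain R where R: "selfadjoint R" "\<forall>x. R (R x) = C x"
    and comm: "\<forall>U. bounded_linear U \<longrightarrow> (\<forall>x. U (C x) = C (U x)) \<longrightarrow> (\<forall>x. U (R x) = R (U x))"
    using positive_sqrt[OF C_sa C_pos C_bound zero_less_numeral] by blast
  have "J (C x) = C (J x)" for x
    by (simp add: C_def D.T_M_eq D.reflect_def D.J_simps)
  then have "R (J x) = J (R x)" for x
    using comm selfadjointD(1)[OF D.J_selfadjoint] by simp
  then interpret H: hypermaximal_pair J Lpos Lneg M1 P R
    using assms(3) M1 P R by unfold_locales (simp_all add: C_def)
  have "infinite {0..1::real}" "infinite {0..<1::real}"
    by (simp_all add: infinite_Icc infinite_Ico)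
  note H.infinite_extensions[OF _ this(1) assms(4), of "\<lambda>a. sqrt (1 - a^2)"
      "\<lambda>L L'. dense_in_HG J L L' (alg_sum Lpos Lneg)"]
    H.infinite_extensions[OF _ this(2) assms(4), of "\<lambda>a. 0"
      "\<lambda>L L'. \<not> dense_in_HG J L L' (alg_sum Lpos Lneg)"]
  then show ?thesis
    using H.dense_if_unitary H.not_dense_if_strict[OF _ assms(4)]
    by (simp add: abs_square_le_1 abs_square_less_1)
qed

end
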